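(* Let $\mathbb{K}$ be any field, let $G$ be a group, and let $X$ be a right $G$-set. Then $X$ is amenable (as a $G$-set) if and only if its linear span $\mathbb{K}X$ is amenable as a right $\mathbb{K}G$-module.
   Context: A right $G$-set $X$ (equivalently, the right action of the discrete group $G$ on the set $X$) is amenable if there exists a function $\mu:2^X\to[0,1]$ such that $\mu(X)=1$, and $\mu(A\sqcup B)=\mu(A)+\mu(B)$ and $\mu(Ag)=\mu(A)$ for all disjoint $A,B\subseteq X$ and all $g\in G$. $\mathbb{K}X$ denotes the $\mathbb{K}$-vector space with basis $X$, regarded as a right module over the group algebra $\mathbb{K}G$ by extending the action of $G$ on $X$ linearly. Let $R$ be an associative $\mathbb{K}$-algebra and $M$ a right $R$-module. $M$ is amenable if for every $\epsilon>0$ and every finite-dimensional subspace $S$ of $R$ there exists a finite-dimensional (nonzero) subspace $F$ of $M$ such that $$\frac{\dim_{\mathbb{K}}((F+Fs)/F)}{\dim_{\mathbb{K}}(F)}<\epsilon\quad\text{for all }s\in S.$$ *)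

theory Defs
  imports Complex_Main "HOL-Library.Poly_Mapping"
begin

section \<open>Finite-dimensional subspaces and quotient spaces\<close>

text \<open>A locale of its own, equal to \<open>vector_space\<close>, because definitions added to
  \<open>vector_space\<close> itself would clash with their copies for \<open>real_vector\<close>.\<close>

locale vspace = vector_space scale
  for scale :: "'a::field \<Rightarrow> 'b::ab_group_add \<Rightarrow> 'b"
begin

definition fin_dim_subspace :: "'b set \<Rightarrow> bool" where
  "fin_dim_subspace V \<longleftrightarrow> subspace V \<and> (\<exists>B. finite B \<and> span B = V)"

definition coset :: "'b set \<Rightarrow> 'b \<Rightarrow> 'b set" where
  "coset W v = (\<lambda>w. v + w) ` W"

definition quotient :: "'b set \<Rightarrow> 'b set \<Rightarrow> 'b set set" where
  "quotient V W = coset W ` V"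

text \<open>The linear combination with coefficients \<open>a\<close> of the cosets in the finite set \<open>T\<close>, formed
  in the quotient space by \<open>W\<close>. The vector space operations of the quotient are computed on
  representatives; see \<open>quotient_lincomb_coset\<close> for the independence of their choice.\<close>

definition quotient_lincomb :: "'b set \<Rightarrow> 'b set set \<Rightarrow> ('b set \<Rightarrow> 'a) \<Rightarrow> 'b set" where
  "quotient_lincomb W T a = coset W (\<Sum>C\<in>T. scale (a C) (SOME v. v \<in> C))"

text \<open>The zero vector of the quotient is the coset \<open>W\<close>.\<close>

definition quotient_independent :: "'b set \<Rightarrow> 'b set set \<Rightarrow> bool" where
  "quotient_independent W B \<longleftrightarrow>
    (\<forall>T a. finite T \<and> T \<subseteq> B \<and> quotient_lincomb W T a = W \<longrightarrow> (\<forall>C\<in>T. a C = 0))"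

definition quotient_basis :: "'b set \<Rightarrow> 'b set \<Rightarrow> 'b set set \<Rightarrow> bool" where
  "quotient_basis V W B \<longleftrightarrow>
    B \<subseteq> quotient V W \<and> quotient_independent W B \<and>
    (\<forall>C\<in>quotient V W. \<exists>T a. finite T \<and> T \<subseteq> B \<and> quotient_lincomb W T a = C)"

text \<open>As for \<open>dim\<close>, the value is meaningful only for a finite-dimensional quotient.\<close>

definition quotient_dim :: "'b set \<Rightarrow> 'b set \<Rightarrow> nat" where
  "quotient_dim V W = card (SOME B. quotient_basis V W B)"

lemma coset_eq_iff:
  assumes "subspace W"
  shows "coset W u = coset W v \<longleftrightarrow> u - v \<in> W"
proof
  assume "coset W u = coset W v"
  moreover have "u \<in> coset W u"
    unfolding coset_def using subspace_0[OF assms] by force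
  ultimately obtain w where "w \<in> W" "u = v + w" by (auto simp: coset_def)
  then show "u - v \<in> W" by simp
next
  assume d: "u - v \<in> W"
  have "u + w \<in> coset W v" if "w \<in> W" for w
    unfolding coset_def using subspace_add[OF assms d that]
    by (intro image_eqI[of _ _ "u - v + w"]) auto
  moreover have "v + w \<in> coset W u" if "w \<in> W" for w
    unfolding coset_def using subspace_diff[OF assms that d]
    by (intro image_eqI[of _ _ "w - (u - v)"]) auto
  ultimately show "coset W u = coset W v" by (auto simp: coset_def)
qed

lemma coset_eq_self_iff:
  assumes "subspace W"
  shows "coset W v = W \<longleftrightarrow> v \<in> W"
  using coset_eq_iff[OF assms, of v 0] by (simp add: coset_def)

lemma some_rep_diff:
  assumes "subspace W"
  shows "(SOME u. u \<in> coset W v) - v \<in> W"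
proof -
  have "v \<in> coset W v" unfolding coset_def using subspace_0[OF assms] by force
  then have "(SOME u. u \<in> coset W v) \<in> coset W v" by (rule someI)
  then show ?thesis by (auto simp: coset_def)
qed

lemma quotient_lincomb_coset:
  assumes W: "subspace W" and v: "\<And>C. C \<in> T \<Longrightarrow> C = coset W (v C)"
  shows "quotient_lincomb W T a = coset W (\<Sum>C\<in>T. scale (a C) (v C))"
proof -
  have "(SOME u. u \<in> C) - v C \<in> W" if "C \<in> T" for C
    using some_rep_diff[OF W, of "v C"] v[OF that] by simp
  then have "(\<Sum>C\<in>T. scale (a C) ((SOME u. u \<in> C) - v C)) \<in> W"
    by (intro subspace_sum[OF W] subspace_scale[OF W]) auto
  then show ?thesis
    unfolding quotient_lincomb_def
    by (simp add: coset_eq_iff[OF W] scale_right_diff_distrib sum_subtractf)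
qed

lemma quotient_basis_card:
  assumes V: "subspace V" and W: "subspace W" and WV: "W \<subseteq> V"
    and B: "quotient_basis V W B" and Wb: "Wb \<subseteq> W" "independent Wb" "span Wb = W"
  shows "\<exists>B'. B' \<inter> Wb = {} \<and> card B' = card B \<and> independent (B' \<union> Wb) \<and> span (B' \<union> Wb) = V"
proof -
  define r where "r C = (SOME v::'b. v \<in> C)" for C
  have BV: "B \<subseteq> quotient V W" using B by (simp add: quotient_basis_def)
  have rC: "C = coset W (r C) \<and> r C \<in> V" if C: "C \<in> quotient V W" for C
  proof -
    obtain v where v: "v \<in> V" "C = coset W v" using C by (auto simp: quotient_def)
    have d: "r C - v \<in> W" using some_rep_diff[OF W, of v] v by (simp add: r_def)
    have "v + (r C - v) \<in> V" using d WV by (intro subspace_add[OF V v(1)]) auto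
    with d show ?thesis using coset_eq_iff[OF W, of "r C" v] v by simp
  qed
  have inj: "inj_on r B"
  proof (rule inj_onI)
    fix C D assume "C \<in> B" "D \<in> B" "r C = r D"
    then show "C = D" using rC[of C] rC[of D] BV by auto
  qed
  have ind: "a C = 0"
    if T: "finite T" "T \<subseteq> B" "(\<Sum>C\<in>T. scale (a C) (r C)) \<in> W" and C: "C \<in> T" for T a C
  proof -
    have "quotient_lincomb W T a = W"
      using T(3) coset_eq_self_iff[OF W] by (simp add: quotient_lincomb_def r_def)
    then show ?thesis
      using B T(1,2) C unfolding quotient_basis_def quotient_independent_def by blast
  qed
  have notW: "r C \<notin> W" if "C \<in> B" for C
    using ind[of "{C}" "\<lambda>_. 1" C] that by auto
  have disj: "r ` B \<inter> Wb = {}" using notW Wb by auto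
  have "independent (r ` B \<union> Wb)"
    unfolding independent_explicit_module
  proof (intro allI impI)
    fix t u v
    assume t: "finite t" "t \<subseteq> r ` B \<union> Wb" and s0: "(\<Sum>v\<in>t. scale (u v) v) = 0" and vt: "v \<in> t"
    define t1 t2 where "t1 = t \<inter> r ` B" and "t2 = t \<inter> Wb"
    have tt: "t = t1 \<union> t2" "t1 \<inter> t2 = {}" "finite t1" "finite t2"
      using t disj by (auto simp: t1_def t2_def)
    have split: "(\<Sum>v\<in>t1. scale (u v) v) + (\<Sum>v\<in>t2. scale (u v) v) = 0"
      using s0 sum.union_disjoint[OF tt(3,4,2), of "\<lambda>v. scale (u v) v"] tt(1) by simp
    have t2W: "(\<Sum>v\<in>t2. scale (u v) v) \<in> W"
      using Wb by (intro subspace_sum[OF W] subspace_scale[OF W]) (auto simp: t2_def)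
    obtain T where T: "T \<subseteq> B" "t1 = r ` T"
      using subset_imageE[of t1 r B] by (auto simp: t1_def)
    have injT: "inj_on r T" using inj T inj_on_subset by blast
    have fT: "finite T" using T tt injT finite_image_iff by blast
    have "(\<Sum>v\<in>t1. scale (u v) v) = (\<Sum>C\<in>T. scale (u (r C)) (r C))"
      using T injT by (simp add: sum.reindex)
    moreover have "(\<Sum>v\<in>t1. scale (u v) v) \<in> W"
      using split t2W subspace_neg[OF W] by (metis add_eq_0_iff2)
    ultimately have u1: "\<And>C. C \<in> T \<Longrightarrow> u (r C) = 0"
      using ind[OF fT T(1), of "\<lambda>C. u (r C)"] by simp
    then have "(\<Sum>v\<in>t1. scale (u v) v) = 0" using T by (intro sum.neutral) auto
    with split have "(\<Sum>v\<in>t2. scale (u v) v) = 0" by simp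
    then have u2: "u v = 0" if "v \<in> t2" for v
      using Wb(2)[unfolded independent_explicit_module, rule_format, of t2 u v] tt(4) that
      by (simp add: t2_def)
    show "u v = 0" using vt tt T u1 u2 by auto
  qed
  moreover have "span (r ` B \<union> Wb) = V"
  proof
    show "span (r ` B \<union> Wb) \<subseteq> V"
      using rC BV Wb WV by (intro span_minimal[OF _ V]) auto
    show "V \<subseteq> span (r ` B \<union> Wb)"
    proof
      fix v assume v: "v \<in> V"
      then have "coset W v \<in> quotient V W" by (simp add: quotient_def)
      then obtain T a where T: "finite T" "T \<subseteq> B" "quotient_lincomb W T a = coset W v"
        using B unfolding quotient_basis_def by blast
      define s where "s = (\<Sum>C\<in>T. scale (a C) (r C))"
      have "v - s \<in> W"
        using T(3)[symmetric] coset_eq_iff[OF W] by (simp add: quotient_lincomb_def r_def s_def)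
      then have "v - s \<in> span (r ` B \<union> Wb)" using Wb span_mono[of Wb "r ` B \<union> Wb"] by auto
      moreover have "s \<in> span (r ` B \<union> Wb)"
        unfolding s_def using T by (intro span_sum span_scale span_base) auto
      ultimately have "(v - s) + s \<in> span (r ` B \<union> Wb)" by (rule span_add)
      then show "v \<in> span (r ` B \<union> Wb)" by simp
    qed
  qed
  ultimately show ?thesis using disj card_image[OF inj] by blast
qed

lemma quotient_basis_exists:
  assumes V: "subspace V" and W: "subspace W" and WV: "W \<subseteq> V"
  shows "\<exists>B. quotient_basis V W B"
proof -
  obtain Wb where Wb: "Wb \<subseteq> W" "independent Wb" "W \<subseteq> span Wb"
    using maximal_independent_subset[of W] by blast
  obtain Vb where Vb: "Wb \<subseteq> Vb" "Vb \<subseteq> V" "independent Vb" "V \<subseteq> span Vb"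
    using maximal_independent_subset_extend[of Wb V] Wb WV by blast
  define D where "D = Vb - Wb"
  have sW: "span Wb = W" using Wb W span_minimal[of Wb W] by blast
  have key: "\<And>v. v \<in> t \<Longrightarrow> u v = 0"
    if t: "finite t" "t \<subseteq> D" and s: "(\<Sum>v\<in>t. scale (u v) v) \<in> W" for t u
  proof -
    fix v assume vt: "v \<in> t"
    from s sW obtain t' u' where t': "finite t'" "t' \<subseteq> Wb"
      "(\<Sum>v\<in>t. scale (u v) v) = (\<Sum>v\<in>t'. scale (u' v) v)"
      unfolding span_explicit by blast
    define q where "q x = (if x \<in> t then u x else - u' x)" for x
    have dj: "t \<inter> t' = {}" using t t' by (auto simp: D_def)
    have "(\<Sum>v\<in>t'. scale (q v) v) = (\<Sum>v\<in>t'. - scale (u' v) v)"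
      using dj by (intro sum.cong) (auto simp: q_def)
    moreover have "(\<Sum>v\<in>t. scale (q v) v) = (\<Sum>v\<in>t. scale (u v) v)"
      by (intro sum.cong) (auto simp: q_def)
    ultimately have "(\<Sum>v\<in>t \<union> t'. scale (q v) v) = 0"
      using t t' dj by (simp add: sum.union_disjoint sum_negf)
    moreover have "t \<union> t' \<subseteq> Vb" using t t' Vb by (auto simp: D_def)
    ultimately have "q v = 0"
      using Vb(3)[unfolded independent_explicit_module, rule_format, of "t \<union> t'" q v]
        t(1) t'(1) vt by simp
    then show "u v = 0" using vt by (simp add: q_def)
  qed
  have inj: "inj_on (coset W) D"
  proof (rule inj_onI, rule ccontr)
    fix x y assume xy: "x \<in> D" "y \<in> D" "coset W x = coset W y" "x \<noteq> y"
    have "(\<Sum>v\<in>{x, y}. scale (if v = x then 1 else - 1) v) \<in> W"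
      using xy coset_eq_iff[OF W] by simp
    from key[OF _ _ this, of x] xy show False by simp
  qed
  define i where "i = inv_into D (coset W)"
  have i: "C = coset W (i C)" "i C \<in> D" if "C \<in> coset W ` D" for C
    using that by (auto simp: i_def f_inv_into_f inv_into_into)
  have linc: "quotient_lincomb W (coset W ` t) a = coset W (\<Sum>v\<in>t. scale (a (coset W v)) v)"
    if "t \<subseteq> D" for t a
  proof -
    have "inj_on (coset W) t" using inj that inj_on_subset by blast
    moreover have "i (coset W v) = v" if "v \<in> t" for v
      using inj that \<open>t \<subseteq> D\<close> by (auto simp: i_def)
    moreover have "quotient_lincomb W (coset W ` t) a
        = coset W (\<Sum>C\<in>coset W ` t. scale (a C) (i C))"
      using that by (intro quotient_lincomb_coset[OF W] i(1)) auto
    ultimately show ?thesis by (simp add: sum.reindex)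
  qed
  have "quotient_basis V W (coset W ` D)"
    unfolding quotient_basis_def quotient_independent_def
  proof (intro conjI allI impI ballI)
    show "coset W ` D \<subseteq> quotient V W" using Vb by (auto simp: quotient_def D_def)
  next
    fix T a C
    assume "finite T \<and> T \<subseteq> coset W ` D \<and> quotient_lincomb W T a = W" and C: "C \<in> T"
    then have T: "finite T" "T \<subseteq> coset W ` D" and q: "quotient_lincomb W T a = W" by auto
    obtain t where t: "t \<subseteq> D" "T = coset W ` t" "finite t"
      using finite_subset_image[OF T] by blast
    have "(\<Sum>v\<in>t. scale (a (coset W v)) v) \<in> W"
      using q linc[OF t(1), of a] t(2) coset_eq_self_iff[OF W] by simp
    then show "a C = 0" using key[OF t(3,1), of "\<lambda>v. a (coset W v)"] C t(2) by auto
  next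
    fix C assume "C \<in> quotient V W"
    then obtain v where v: "v \<in> V" "C = coset W v" by (auto simp: quotient_def)
    then obtain t u where t: "finite t" "t \<subseteq> Vb" "v = (\<Sum>v\<in>t. scale (u v) v)"
      using Vb(4) unfolding span_explicit by blast
    have "v = (\<Sum>v\<in>t \<inter> D. scale (u v) v) + (\<Sum>v\<in>t - D. scale (u v) v)"
      unfolding t(3) by (rule sum.Int_Diff[OF t(1)])
    moreover have "(\<Sum>v\<in>t - D. scale (u v) v) \<in> W"
      using t Wb by (intro subspace_sum[OF W] subspace_scale[OF W]) (auto simp: D_def)
    ultimately have "v - (\<Sum>v\<in>t \<inter> D. scale (u v) v) \<in> W"
      by (metis add_diff_cancel_left')
    then have "C = coset W (\<Sum>v\<in>t \<inter> D. scale (u v) v)"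
      using v coset_eq_iff[OF W] by blast
    also have "\<dots> = coset W (\<Sum>v\<in>t \<inter> D. scale (u (i (coset W v))) v)"
      using inj by (intro arg_cong[of _ _ "coset W"] sum.cong) (auto simp: i_def)
    also have "\<dots> = quotient_lincomb W (coset W ` (t \<inter> D)) (\<lambda>C. u (i C))"
      by (rule linc[symmetric]) simp
    finally show "\<exists>T a. finite T \<and> T \<subseteq> coset W ` D \<and> quotient_lincomb W T a = C"
      using t(1) by (intro exI[of _ "coset W ` (t \<inter> D)"] exI[of _ "\<lambda>C. u (i C)"]) auto
  qed
  then show ?thesis by blast
qed

lemma quotient_dim_eq:
  assumes V: "fin_dim_subspace V" and W: "subspace W" and WV: "W \<subseteq> V"
  shows "quotient_dim V W + dim W = dim V"
proof -
  obtain S where S: "finite S" "span S = V" and sV: "subspace V"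
    using V by (auto simp: fin_dim_subspace_def)
  obtain Wb where Wb: "Wb \<subseteq> W" "independent Wb" "W \<subseteq> span Wb"
    using maximal_independent_subset[of W] by blast
  have sW: "span Wb = W" using Wb W span_minimal[of Wb W] by blast
  define B where "B = (SOME B. quotient_basis V W B)"
  have B: "quotient_basis V W B"
    using quotient_basis_exists[OF sV W WV] unfolding B_def by (rule someI_ex)
  obtain B' where B': "B' \<inter> Wb = {}" "card B' = card B" "independent (B' \<union> Wb)"
      "span (B' \<union> Wb) = V"
    using quotient_basis_card[OF sV W WV B Wb(1,2) sW] by blast
  have "finite (B' \<union> Wb)"
    using independent_span_bound[OF S(1) B'(3)] B'(4) S(2) span_superset by blast
  then have "card (B' \<union> Wb) = card B' + card Wb" using B'(1) by (auto intro: card_Un_disjoint)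
  moreover have "dim V = card (B' \<union> Wb)"
    using B'(3,4) dim_eq_card_independent dim_span by metis
  moreover have "dim W = card Wb" using Wb(2) sW dim_eq_card_independent dim_span by metis
  ultimately show ?thesis using B'(2) by (simp add: quotient_dim_def B_def)
qed

end


section \<open>Right modules over an algebra\<close>

text \<open>The ring \<open>'r\<close> with scalar multiplication \<open>sR\<close> is an associative algebra over the field
  \<open>'k\<close>. The module is a subspace \<open>M\<close> of an ambient vector space, so that a module spanned by
  a set which is not a type is covered.\<close>

locale right_module =
  R: vspace sR + A: vspace sM
  for sR :: "'k::field \<Rightarrow> 'r::ring \<Rightarrow> 'r" and sM :: "'k \<Rightarrow> 'm::ab_group_add \<Rightarrow> 'm" +
  fixes M :: "'m set" and act :: "'m \<Rightarrow> 'r \<Rightarrow> 'm"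
  assumes algebra_left: "sR c a * b = sR c (a * b)"
    and algebra_right: "a * sR c b = sR c (a * b)"
    and subspace_M: "A.subspace M"
    and act_closed: "m \<in> M \<Longrightarrow> act m a \<in> M"
    and act_add_left: "m \<in> M \<Longrightarrow> n \<in> M \<Longrightarrow> act (m + n) a = act m a + act n a"
    and act_add_right: "m \<in> M \<Longrightarrow> act m (a + b) = act m a + act m b"
    and act_scale_left: "m \<in> M \<Longrightarrow> act (sM c m) a = sM c (act m a)"
    and act_scale_right: "m \<in> M \<Longrightarrow> act m (sR c a) = sM c (act m a)"
    and act_mult: "m \<in> M \<Longrightarrow> act m (a * b) = act (act m a) b"
begin

text \<open>\<open>translate_sum F s\<close> is the subspace written \<open>F + Fs\<close>.\<close>

definition translate_sum :: "'m set \<Rightarrow> 'r \<Rightarrow> 'm set" where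
  "translate_sum F s = {u + act v s | u v. u \<in> F \<and> v \<in> F}"

definition amenable :: bool where
  "amenable \<longleftrightarrow>
    (\<forall>\<epsilon>::real. \<forall>S. \<epsilon> > 0 \<and> R.fin_dim_subspace S \<longrightarrow>
      (\<exists>F. F \<subseteq> M \<and> A.fin_dim_subspace F \<and> F \<noteq> {0} \<and>
        (\<forall>s\<in>S. real (A.quotient_dim (translate_sum F s) F) / real (A.dim F) < \<epsilon>)))"

end


section \<open>Right G-sets\<close>

text \<open>The group is a type of class \<open>group_add\<close>, whose operation is written additively but is not
  assumed to be commutative: \<open>g + h\<close> is the product of \<open>g\<close> and \<open>h\<close> in the group, and \<open>0\<close> is its
  neutral element.  With this convention, \<open>'g \<Rightarrow>\<^sub>0 'k\<close> with its library multiplication (convolution) is the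
  group algebra. The set \<open>X\<close> may be empty.\<close>

locale right_gset =
  fixes X :: "'x set" and act :: "'x \<Rightarrow> 'g::group_add \<Rightarrow> 'x"
  assumes closed: "x \<in> X \<Longrightarrow> act x g \<in> X"
    and act_zero: "x \<in> X \<Longrightarrow> act x 0 = x"
    and act_add: "x \<in> X \<Longrightarrow> act x (g + h) = act (act x g) h"
begin

text \<open>The values of \<open>\<mu>\<close> outside the power set of \<open>X\<close> are irrelevant.\<close>

definition amenable :: bool where
  "amenable \<longleftrightarrow>
    (\<exists>\<mu> :: 'x set \<Rightarrow> real.
      (\<forall>A. A \<subseteq> X \<longrightarrow> 0 \<le> \<mu> A \<and> \<mu> A \<le> 1) \<and>
      \<mu> X = 1 \<and>
      (\<forall>A B. A \<subseteq> X \<and> B \<subseteq> X \<and> A \<inter> B = {} \<longrightarrow> \<mu> (A \<union> B) = \<mu> A + \<mu> B) \<and>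
      (\<forall>A g. A \<subseteq> X \<longrightarrow> \<mu> ((\<lambda>x. act x g) ` A) = \<mu> A))"

end


section \<open>The group algebra and the module spanned by a G-set\<close>

definition scale_pm :: "'k::field \<Rightarrow> ('a \<Rightarrow>\<^sub>0 'k) \<Rightarrow> ('a \<Rightarrow>\<^sub>0 'k)" where
  "scale_pm c f = Poly_Mapping.map ((*) c) f"

definition span_of :: "'x set \<Rightarrow> ('x \<Rightarrow>\<^sub>0 'k::field) set" where
  "span_of X = {f. Poly_Mapping.keys f \<subseteq> X}"

definition linear_act ::
  "('x \<Rightarrow> 'g \<Rightarrow> 'x) \<Rightarrow> ('x \<Rightarrow>\<^sub>0 'k::field) \<Rightarrow> ('g \<Rightarrow>\<^sub>0 'k) \<Rightarrow> ('x \<Rightarrow>\<^sub>0 'k)" where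
  "linear_act act f a =
    (\<Sum>x\<in>Poly_Mapping.keys f. \<Sum>g\<in>Poly_Mapping.keys a.
      Poly_Mapping.single (act x g) (Poly_Mapping.lookup f x * Poly_Mapping.lookup a g))"

lemma lookup_scale_pm [simp]:
  "Poly_Mapping.lookup (scale_pm c f) k = c * Poly_Mapping.lookup f k"
  by (simp add: scale_pm_def Poly_Mapping.map.rep_eq when_def)

lemma vspace_scale_pm: "vspace (scale_pm :: 'k::field \<Rightarrow> ('a \<Rightarrow>\<^sub>0 'k) \<Rightarrow> _)"
  by unfold_locales (auto intro!: poly_mapping_eqI simp: lookup_add algebra_simps)

lemma linear_act_superset:
  assumes "finite A" "Poly_Mapping.keys f \<subseteq> A" "finite B" "Poly_Mapping.keys a \<subseteq> B"
  shows "linear_act act f a = (\<Sum>x\<in>A. \<Sum>g\<in>B.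
      Poly_Mapping.single (act x g) (Poly_Mapping.lookup f x * Poly_Mapping.lookup a g))"
proof -
  have "linear_act act f a = (\<Sum>x\<in>A. \<Sum>g\<in>Poly_Mapping.keys a.
      Poly_Mapping.single (act x g) (Poly_Mapping.lookup f x * Poly_Mapping.lookup a g))"
    unfolding linear_act_def using assms
    by (intro sum.mono_neutral_left) (auto simp: in_keys_iff)
  also have "\<dots> = (\<Sum>x\<in>A. \<Sum>g\<in>B.
      Poly_Mapping.single (act x g) (Poly_Mapping.lookup f x * Poly_Mapping.lookup a g))"
    using assms by (intro sum.cong sum.mono_neutral_left) (auto simp: in_keys_iff)
  finally show ?thesis .
qed

lemma linear_act_add_left: "linear_act act (f + f') a = linear_act act f a + linear_act act f' a"
proof -
  let ?A = "Poly_Mapping.keys f \<union> Poly_Mapping.keys f'" and ?B = "Poly_Mapping.keys a"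
  show ?thesis
    using Poly_Mapping.keys_add[of f f']
    by (simp add: linear_act_superset[of ?A _ ?B] lookup_add distrib_right single_add sum.distrib)
qed

lemma linear_act_add_right: "linear_act act f (a + b) = linear_act act f a + linear_act act f b"
proof -
  let ?A = "Poly_Mapping.keys f" and ?B = "Poly_Mapping.keys a \<union> Poly_Mapping.keys b"
  show ?thesis
    using Poly_Mapping.keys_add[of a b]
    by (simp add: linear_act_superset[of ?A _ ?B] lookup_add distrib_left single_add sum.distrib)
qed

lemma scale_pm_single [simp]:
  "scale_pm c (Poly_Mapping.single k d) = Poly_Mapping.single k (c * d)"
  by (simp add: scale_pm_def)

lemma scale_pm_sum: "scale_pm c (sum f A) = (\<Sum>i\<in>A. scale_pm c (f i))"
  by (rule poly_mapping_eqI) (simp add: lookup_sum sum_distrib_left)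

lemma keys_scale_pm: "Poly_Mapping.keys (scale_pm c f) \<subseteq> Poly_Mapping.keys f"
  by (auto simp: in_keys_iff)

lemma linear_act_scale_left: "linear_act act (scale_pm c f) a = scale_pm c (linear_act act f a)"
  using keys_scale_pm[of c f]
  by (simp add: linear_act_superset[of "Poly_Mapping.keys f" _ "Poly_Mapping.keys a"]
      scale_pm_sum mult.assoc)

lemma linear_act_scale_right: "linear_act act f (scale_pm c a) = scale_pm c (linear_act act f a)"
  using keys_scale_pm[of c a]
  by (simp add: linear_act_superset[of "Poly_Mapping.keys f" _ "Poly_Mapping.keys a"]
      scale_pm_sum mult.left_commute)

lemma linear_act_single [simp]:
  "linear_act act (Poly_Mapping.single x c) (Poly_Mapping.single g d)
    = Poly_Mapping.single (act x g) (c * d)"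
  by (simp add: linear_act_superset[of "{x}" _ "{g}"])

lemma poly_mapping_additive_eqI:
  fixes F G :: "('a \<Rightarrow>\<^sub>0 'k::field) \<Rightarrow> 'b::ab_group_add"
  assumes F: "\<And>f g. F (f + g) = F f + F g" and G: "\<And>f g. G (f + g) = G f + G g"
    and eq: "\<And>x. x \<in> Poly_Mapping.keys f \<Longrightarrow>
      F (Poly_Mapping.single x (Poly_Mapping.lookup f x)) =
      G (Poly_Mapping.single x (Poly_Mapping.lookup f x))"
  shows "F f = G f"
proof -
  have F0: "F 0 = 0" and G0: "G 0 = 0" using F[of 0 0] G[of 0 0] by simp_all
  have Fs: "F (sum h A) = (\<Sum>x\<in>A. F (h x))" for h and A :: "'a set"
    using F F0 by (induction A rule: infinite_finite_induct) auto
  have Gs: "G (sum h A) = (\<Sum>x\<in>A. G (h x))" for h and A :: "'a set"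
    using G G0 by (induction A rule: infinite_finite_induct) auto
  have f: "(\<Sum>x\<in>Poly_Mapping.keys f. Poly_Mapping.single x (Poly_Mapping.lookup f x)) = f"
    by (rule poly_mapping_eqI)
      (simp add: lookup_sum lookup_single when_def in_keys_iff)
  have "F (\<Sum>x\<in>Poly_Mapping.keys f. Poly_Mapping.single x (Poly_Mapping.lookup f x))
      = G (\<Sum>x\<in>Poly_Mapping.keys f. Poly_Mapping.single x (Poly_Mapping.lookup f x))"
    unfolding Fs Gs by (intro sum.cong refl eq)
  then show ?thesis by (simp only: f)
qed

lemma (in right_gset) linear_act_mult:
  fixes f :: "'x \<Rightarrow>\<^sub>0 'k::field"
  assumes f: "f \<in> span_of X"
  shows "linear_act act f (a * b) = linear_act act (linear_act act f a) b"
proof (rule poly_mapping_additive_eqI[of "\<lambda>f. linear_act act f (a * b)"])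
  fix x assume "x \<in> Poly_Mapping.keys f"
  then have x: "x \<in> X" using f by (auto simp: span_of_def)
  let ?s = "Poly_Mapping.single x (Poly_Mapping.lookup f x)"
  show "linear_act act ?s (a * b) = linear_act act (linear_act act ?s a) b"
  proof (rule poly_mapping_additive_eqI[of "\<lambda>a. linear_act act ?s (a * b)"])
    fix g
    let ?a = "Poly_Mapping.single g (Poly_Mapping.lookup a g)"
    show "linear_act act ?s (?a * b) = linear_act act (linear_act act ?s ?a) b"
    proof (rule poly_mapping_additive_eqI[of "\<lambda>b. linear_act act ?s (?a * b)"])
      fix h
      show "linear_act act ?s (?a * Poly_Mapping.single h (Poly_Mapping.lookup b h))
        = linear_act act (linear_act act ?s ?a) (Poly_Mapping.single h (Poly_Mapping.lookup b h))"
        by (simp add: mult_single act_add[OF x] mult.assoc)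
    qed (simp_all add: distrib_left linear_act_add_right)
  qed (simp_all add: distrib_right linear_act_add_right linear_act_add_left)
qed (simp_all add: linear_act_add_left)

lemma (in right_gset) linear_act_one:
  assumes "f \<in> span_of X"
  shows "linear_act act f 1 = f"
proof (rule poly_mapping_additive_eqI[of "\<lambda>f. linear_act act f 1"])
  fix x assume "x \<in> Poly_Mapping.keys f"
  then have "x \<in> X" using assms by (auto simp: span_of_def)
  then show "linear_act act (Poly_Mapping.single x (Poly_Mapping.lookup f x)) 1
      = Poly_Mapping.single x (Poly_Mapping.lookup f x)"
    by (simp flip: single_one add: act_zero)
qed (simp_all add: linear_act_add_left)

lemma (in right_gset) right_module_span_of:
  "right_module scale_pm scale_pm (span_of X :: ('x \<Rightarrow>\<^sub>0 'k::field) set) (linear_act act)"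
proof -
  interpret R: vspace "scale_pm :: 'k \<Rightarrow> ('g \<Rightarrow>\<^sub>0 'k) \<Rightarrow> _" by (rule vspace_scale_pm)
  interpret A: vspace "scale_pm :: 'k \<Rightarrow> ('x \<Rightarrow>\<^sub>0 'k) \<Rightarrow> _" by (rule vspace_scale_pm)
  have single0: "scale_pm c a = Poly_Mapping.single 0 c * a" for c and a :: "'g \<Rightarrow>\<^sub>0 'k"
    by (simp add: scale_pm_def mult_map_scale_conv_mult)
  show ?thesis
  proof
    fix c :: 'k and a b :: "'g \<Rightarrow>\<^sub>0 'k"
    show "scale_pm c a * b = scale_pm c (a * b)" by (simp add: single0 mult.assoc)
    show "a * scale_pm c b = scale_pm c (a * b)"
    proof (rule poly_mapping_additive_eqI[of "\<lambda>a. a * scale_pm c b"])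
      fix g
      let ?a = "Poly_Mapping.single g (Poly_Mapping.lookup a g)"
      have "?a * Poly_Mapping.single 0 c = Poly_Mapping.single 0 c * ?a"
        by (simp add: mult_single mult.commute)
      then show "?a * scale_pm c b = scale_pm c (?a * b)"
        by (simp add: single0 flip: mult.assoc)
    qed (simp_all add: distrib_right R.scale_right_distrib)
  next
    show "A.subspace (span_of X)"
    proof (rule A.subspaceI)
      fix f g :: "'x \<Rightarrow>\<^sub>0 'k" assume "f \<in> span_of X" "g \<in> span_of X"
      then show "f + g \<in> span_of X" using Poly_Mapping.keys_add[of f g] by (auto simp: span_of_def)
    next
      fix c and f :: "'x \<Rightarrow>\<^sub>0 'k" assume "f \<in> span_of X"
      then show "scale_pm c f \<in> span_of X" using keys_scale_pm[of c f] by (auto simp: span_of_def)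
    qed (simp add: span_of_def)
    then show "linear_act act m a \<in> span_of X" if "m \<in> span_of X"
      for m :: "'x \<Rightarrow>\<^sub>0 'k" and a
      using that closed unfolding linear_act_def
      by (intro A.subspace_sum) (auto simp: span_of_def)
  qed (simp_all add: linear_act_add_left linear_act_add_right linear_act_scale_left
      linear_act_scale_right linear_act_mult)
qed

end

theory Submission
  imports Defs "HOL-Analysis.Function_Topology" "HOL-Combinatorics.Permutations"
begin

text \<open>If \<open>X\<close> is amenable, it has Folner sets \<open>A\<close> (otherwise Hall's theorem
  duplicates \<open>X\<close> piecewise), and the spans of the sets \<open>A\<close> are almost invariant subspaces.
  Conversely, a finite-dimensional subspace \<open>F\<close> of the span and a linear order on \<open>X\<close> determine
  a set of \<open>dim F\<close> leading positions. It increases with \<open>F\<close> and is equivariant, but only if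
  \<open>G\<close> also moves the order. Averaging over all orders removes the dependence on the order and
  turns almost invariant subspaces into almost invariant probability measures on \<open>X\<close>; a limit
  point of these is an invariant mean.\<close>

section \<open>Hall's marriage theorem for families of finite sets\<close>

text \<open>Rado's proof: by Zorn's lemma, delete as many pairs as Hall's condition permits. In the
  minimal relation that remains, every index has exactly one partner. Finiteness of the sets
  \<open>A i\<close> makes the condition survive unions of chains of deletions.\<close>

lemma marriage:
  fixes A :: "'i \<Rightarrow> 'a set"
  assumes fin: "\<And>i. i \<in> I \<Longrightarrow> finite (A i)"
    and hall: "\<And>J. finite J \<Longrightarrow> J \<subseteq> I \<Longrightarrow> card J \<le> card (\<Union>i\<in>J. A i)"
  obtains f where "inj_on f I" "\<And>i. i \<in> I \<Longrightarrow> f i \<in> A i"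
proof -
  define ok where "ok R \<longleftrightarrow> (\<forall>J. finite J \<and> J \<subseteq> I \<longrightarrow> card J \<le> card (R `` J))"
    for R :: "('i \<times> 'a) set"
  \<comment> \<open>The sets of pairs that can be deleted without violating Hall's condition; a
    maximal one leaves a minimal relation.\<close>
  define \<D> where "\<D> = {D. D \<subseteq> Sigma I A \<and> ok (Sigma I A - D)}"
  have "ok (Sigma I A)"
    unfolding ok_def
  proof (intro allI impI)
    fix J assume J: "finite J \<and> J \<subseteq> I"
    then have "Sigma I A `` J = (\<Union>i\<in>J. A i)" by auto
    then show "card J \<le> card (Sigma I A `` J)" using hall J by auto
  qed
  then have "{} \<in> \<D>" by (simp add: \<D>_def)
  have "\<exists>M\<in>\<D>. \<forall>X\<in>\<D>. M \<subseteq> X \<longrightarrow> X = M"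
  proof (rule subset_Zorn_nonempty)
    show "\<D> \<noteq> {}" using \<open>{} \<in> \<D>\<close> by blast
  next
    fix \<C> assume ne: "\<C> \<noteq> {}" and ch: "subset.chain \<D> \<C>"
    then have sub: "\<C> \<subseteq> \<D>" by (simp add: subset_chain_def)
    have "ok (Sigma I A - \<Union>\<C>)"
      unfolding ok_def
    proof (intro allI impI)
      fix J assume J: "finite J \<and> J \<subseteq> I"
      \<comment> \<open>Only finitely many pairs lie over \<open>J\<close>, so a single member of
        the chain already deletes all those that the union deletes there.\<close>
      then have "finite (Sigma J A)" using fin by auto
      then have "finite (\<Union>\<C> \<inter> Sigma J A)" "\<Union>\<C> \<inter> Sigma J A \<subseteq> \<Union>\<C>" by auto
      then obtain D where D: "D \<in> \<C>" "\<Union>\<C> \<inter> Sigma J A \<subseteq> D"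
        using finite_subset_Union_chain[OF _ _ ne ch] by metis
      then have "(Sigma I A - \<Union>\<C>) `` J = (Sigma I A - D) `` J" using J by auto
      then show "card J \<le> card ((Sigma I A - \<Union>\<C>) `` J)"
        using D(1) sub J by (auto simp: \<D>_def ok_def)
    qed
    then show "\<Union>\<C> \<in> \<D>" using sub by (auto simp: \<D>_def)
  qed
  then obtain D where D: "D \<in> \<D>" and max: "\<And>X. X \<in> \<D> \<Longrightarrow> D \<subseteq> X \<Longrightarrow> X = D" by blast
  define R where "R = Sigma I A - D"
  have R: "ok R" "R \<subseteq> Sigma I A" using D by (auto simp: R_def \<D>_def)
  have okD: "card J \<le> card (R `` J)" if "finite J" "J \<subseteq> I" for J
    using R(1) that by (simp add: ok_def)
  have finR: "finite (R `` J)" if "finite J" for J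
  proof (rule finite_subset)
    show "R `` J \<subseteq> (\<Union>i\<in>J \<inter> I. A i)" using R by auto
    show "finite (\<Union>i\<in>J \<inter> I. A i)" using that fin by auto
  qed
  \<comment> \<open>By maximality, deleting \<open>(i, x)\<close> as well violates the condition at
    some finite set, which must contain \<open>i\<close>. Dropping \<open>i\<close> from that set
    turns the strict inequality into the weak one.\<close>
  have tight: "\<exists>J. finite J \<and> J \<subseteq> I \<and> i \<notin> J \<and> card (R `` J \<union> (R `` {i} - {x})) \<le> card J"
    if ix: "(i, x) \<in> R" for i x
  proof -
    have "insert (i, x) D \<notin> \<D>" using max[of "insert (i, x) D"] ix by (auto simp: R_def)
    moreover have "Sigma I A - insert (i, x) D = R - {(i, x)}" by (auto simp: R_def)
    moreover have "insert (i, x) D \<subseteq> Sigma I A" using D ix R(2) by (auto simp: \<D>_def)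
    ultimately obtain J where J: "finite J" "J \<subseteq> I" "card ((R - {(i, x)}) `` J) < card J"
      by (auto simp: \<D>_def ok_def not_le)
    have iJ: "i \<in> J"
    proof (rule ccontr)
      assume "i \<notin> J"
      then have "(R - {(i, x)}) `` J = R `` J" by auto
      with J okD[of J] show False by simp
    qed
    have "R `` (J - {i}) \<union> (R `` {i} - {x}) = (R - {(i, x)}) `` J"
      using iJ by auto
    then show ?thesis using J iJ by (intro exI[of _ "J - {i}"]) (auto simp: card_Diff_singleton)
  qed
  \<comment> \<open>As \<open>x \<noteq> y\<close>, the union of \<open>P\<close> and
    \<open>Q\<close> below contains all partners of \<open>insert i (J \<union> K)\<close>, while
    their intersection contains those of \<open>J \<inter> K\<close>. Hence
    \<open>card P + card Q\<close> is at least \<open>card J + card K + 1\<close>, against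
    tightness.\<close>
  have unique: "x = y" if xy: "(i, x) \<in> R" "(i, y) \<in> R" for i x y
  proof (rule ccontr)
    assume ne: "x \<noteq> y"
    obtain J where J: "finite J" "J \<subseteq> I" "i \<notin> J" "card (R `` J \<union> (R `` {i} - {x})) \<le> card J"
      using tight[OF xy(1)] by blast
    obtain K where K: "finite K" "K \<subseteq> I" "i \<notin> K" "card (R `` K \<union> (R `` {i} - {y})) \<le> card K"
      using tight[OF xy(2)] by blast
    define P Q where "P = R `` J \<union> (R `` {i} - {x})" and "Q = R `` K \<union> (R `` {i} - {y})"
    have f: "finite P" "finite Q" using finR J K by (auto simp: P_def Q_def)
    have "P \<union> Q = R `` insert i (J \<union> K)" using ne by (auto simp: P_def Q_def)
    moreover have "i \<in> I" using xy R by auto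
    ultimately have "card (insert i (J \<union> K)) \<le> card (P \<union> Q)"
      using okD[of "insert i (J \<union> K)"] J K by simp
    moreover have "card (J \<inter> K) \<le> card (P \<inter> Q)"
    proof -
      have "card (J \<inter> K) \<le> card (R `` (J \<inter> K))" using okD[of "J \<inter> K"] J by blast
      also have "\<dots> \<le> card (P \<inter> Q)" using f by (intro card_mono) (auto simp: P_def Q_def)
      finally show ?thesis .
    qed
    moreover have "card (insert i (J \<union> K)) = Suc (card (J \<union> K))" using J K by auto
    moreover have "card P + card Q = card (P \<union> Q) + card (P \<inter> Q)"
      by (rule card_Un_Int[OF f])
    moreover have "card J + card K = card (J \<union> K) + card (J \<inter> K)"
      by (rule card_Un_Int[OF J(1) K(1)])
    moreover have "card P \<le> card J" "card Q \<le> card K" using J K by (auto simp: P_def Q_def)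
    ultimately show False by linarith
  qed
  have ex: "\<exists>x. (i, x) \<in> R" if "i \<in> I" for i
  proof -
    have "card {i} \<le> card (R `` {i})" using okD[of "{i}"] that by blast
    then have "R `` {i} \<noteq> {}" by auto
    then show ?thesis by auto
  qed
  define f where "f i = (SOME x. (i, x) \<in> R)" for i
  have f: "(i, f i) \<in> R" if "i \<in> I" for i unfolding f_def by (rule someI_ex[OF ex[OF that]])
  show thesis
  proof
    show "f i \<in> A i" if "i \<in> I" for i using f[OF that] R by auto
    show "inj_on f I"
    proof (rule inj_onI, rule ccontr)
      fix i j assume ij: "i \<in> I" "j \<in> I" "f i = f j" "i \<noteq> j"
      \<comment> \<open>Both indices have this one partner, whereas Hall's condition grants the pair
        two.\<close>
      have "R `` {i, j} \<subseteq> {f i}" using unique f ij by fastforce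
      then have "card (R `` {i, j}) \<le> card {f i}" by (intro card_mono) auto
      moreover have "card {i, j} \<le> card (R `` {i, j})" using okD[of "{i, j}"] ij by blast
      ultimately show False using ij by simp
    qed
  qed
qed

section \<open>Invariant means and Folner sets\<close>

locale invariant_mean = right_gset X act
  for X :: "'x set" and act :: "'x \<Rightarrow> 'g::group_add \<Rightarrow> 'x" +
  fixes \<mu> :: "'x set \<Rightarrow> real"
  assumes nonneg: "A \<subseteq> X \<Longrightarrow> 0 \<le> \<mu> A"
    and le_one: "A \<subseteq> X \<Longrightarrow> \<mu> A \<le> 1"
    and total: "\<mu> X = 1"
    and additive: "A \<subseteq> X \<Longrightarrow> B \<subseteq> X \<Longrightarrow> A \<inter> B = {} \<Longrightarrow> \<mu> (A \<union> B) = \<mu> A + \<mu> B"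
    and invariant: "A \<subseteq> X \<Longrightarrow> \<mu> ((\<lambda>x. act x g) ` A) = \<mu> A"
begin

lemma finite_additive:
  assumes "finite I" "\<And>i. i \<in> I \<Longrightarrow> B i \<subseteq> X" "disjoint_family_on B I"
  shows "\<mu> (\<Union>i\<in>I. B i) = (\<Sum>i\<in>I. \<mu> (B i))"
  using assms
proof (induction I rule: finite_induct)
  case empty
  then show ?case using additive[of "{}" "{}"] by simp
next
  case (insert i I)
  have "B i \<inter> (\<Union>i\<in>I. B i) = {}"
    using insert.prems(2) insert.hyps(2) unfolding disjoint_family_on_def by fastforce
  moreover have "disjoint_family_on B I"
    using insert.prems(2) unfolding disjoint_family_on_def by auto
  ultimately show ?case
    using insert additive[of "B i" "\<Union>i\<in>I. B i"] by (simp add: UN_subset_iff)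
qed

text \<open>Cut \<open>X\<close> into the finitely many pieces on which \<open>\<psi>\<close> is
  translation by one fixed \<open>w\<close>. Invariance preserves the mean of each piece, and
  injectivity keeps the images disjoint.\<close>

lemma piecewise_translation:
  assumes W: "finite W" and \<psi>: "\<And>x. x \<in> X \<Longrightarrow> \<exists>w\<in>W. \<psi> x = act x w" and inj: "inj_on \<psi> X"
  shows "\<mu> (\<psi> ` X) = 1"
proof -
  obtain w where w: "\<And>x. x \<in> X \<Longrightarrow> w x \<in> W" "\<And>x. x \<in> X \<Longrightarrow> \<psi> x = act x (w x)"
    using \<psi> by metis
  define B where "B v = {x \<in> X. w x = v}" for v
  have B: "(\<Union>v\<in>W. B v) = X" "B v \<subseteq> X" "disjoint_family_on B W" for v
    using w(1) by (auto simp: B_def disjoint_family_on_def)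
  have im: "\<psi> ` B v = (\<lambda>x. act x v) ` B v" for v
    using w(2) by (intro image_cong) (auto simp: B_def)
  have "disjoint_family_on (\<lambda>v. \<psi> ` B v) W"
    using inj by (auto simp: B_def disjoint_family_on_def inj_on_def)
  moreover have "\<psi> ` B v \<subseteq> X" for v
    unfolding im using closed B(2) by blast
  ultimately have "\<mu> (\<Union>v\<in>W. \<psi> ` B v) = (\<Sum>v\<in>W. \<mu> (\<psi> ` B v))"
    using W by (intro finite_additive) auto
  also have "\<dots> = (\<Sum>v\<in>W. \<mu> (B v))" by (simp add: im invariant B(2))
  also have "\<dots> = \<mu> X" using finite_additive[OF W B(2,3)] B(1) by simp
  finally show ?thesis using B(1) total by (metis image_UN)
qed

end

lemma (in right_gset) amenable_iff_invariant_mean: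
  "amenable \<longleftrightarrow> (\<exists>\<mu>. invariant_mean X act \<mu>)"
proof
  assume amenable
  then show "\<exists>\<mu>. invariant_mean X act \<mu>"
    unfolding amenable_def
  proof (elim exE conjE)
    fix \<mu> :: "'x set \<Rightarrow> real"
    assume \<mu>: "\<forall>A\<subseteq>X. 0 \<le> \<mu> A \<and> \<mu> A \<le> 1" "\<mu> X = 1"
      "\<forall>A B. A \<subseteq> X \<and> B \<subseteq> X \<and> A \<inter> B = {} \<longrightarrow> \<mu> (A \<union> B) = \<mu> A + \<mu> B"
      "\<forall>A g. A \<subseteq> X \<longrightarrow> \<mu> ((\<lambda>x. act x g) ` A) = \<mu> A"
    have "invariant_mean X act \<mu>" by unfold_locales (simp_all add: \<mu>)
    then show "\<exists>\<mu>. invariant_mean X act \<mu>" by blast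
  qed
next
  assume "\<exists>\<mu>. invariant_mean X act \<mu>"
  then obtain \<mu> where "invariant_mean X act \<mu>" by blast
  then interpret invariant_mean X act \<mu> .
  show amenable
    unfolding amenable_def using nonneg le_one total additive invariant
    by (intro exI[of _ \<mu>]) simp
qed

section \<open>Translates of finite sets and their growth\<close>

definition translates :: "('x \<Rightarrow> 'g \<Rightarrow> 'x) \<Rightarrow> 'x set \<Rightarrow> 'g set \<Rightarrow> 'x set" where
  "translates act A W = (\<Union>x\<in>A. act x ` W)"

lemma finite_translates: "finite A \<Longrightarrow> finite W \<Longrightarrow> finite (translates act A W)"
  by (simp add: translates_def)

context right_gset
begin

lemma translates_subset: "A \<subseteq> X \<Longrightarrow> translates act A W \<subseteq> X"
  using closed by (auto simp: translates_def)

lemma subset_translates: "A \<subseteq> X \<Longrightarrow> 0 \<in> W \<Longrightarrow> A \<subseteq> translates act A W"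
  using act_zero by (force simp: translates_def)

lemma inj_on_act: "inj_on (\<lambda>x. act x g) X"
proof (rule inj_on_inverseI)
  show "act (act x g) (- g) = x" if "x \<in> X" for x
    using act_add[OF that, of g "- g"] act_zero[OF that] by simp
qed

lemma translates_translates:
  assumes "A \<subseteq> X"
  shows "translates act (translates act A V) W = translates act A (\<Union>v\<in>V. (+) v ` W)"
proof -
  have "act (act x v) w = act x (v + w)" if "x \<in> A" for x v w
    using that assms by (auto simp: act_add)
  then show ?thesis by (simp add: translates_def image_UN image_image) blast
qed

text \<open>Translating by \<open>W\<close> and then by \<open>U\<close> is translating by the
  product set, so growth factors multiply. A factor above 1 can in this way be raised beyond
  2.\<close>

lemma expansion_power:
  assumes U: "finite U" and c: "c \<ge> (0::real)"
    and exp: "\<And>A. finite A \<Longrightarrow> A \<subseteq> X \<Longrightarrow> c * card A \<le> card (translates act A U)"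
  shows "\<exists>W. finite W \<and> (\<forall>A. finite A \<longrightarrow> A \<subseteq> X \<longrightarrow> c ^ n * card A \<le> card (translates act A W))"
proof (induction n)
  case 0
  have "card A \<le> card (translates act A {0})" if "finite A" "A \<subseteq> X" for A
    using subset_translates[OF that(2), of "{0}"] that
    by (intro card_mono finite_translates) auto
  then show ?case by (intro exI[of _ "{0}"]) auto
next
  case (Suc n)
  then obtain W where W: "finite W"
    "\<And>A. finite A \<Longrightarrow> A \<subseteq> X \<Longrightarrow> c ^ n * card A \<le> card (translates act A W)" by blast
  have "c ^ Suc n * card A \<le> card (translates act A (\<Union>v\<in>W. (+) v ` U))"
    if A: "finite A" "A \<subseteq> X" for A
  proof -
    have "c ^ Suc n * card A \<le> c * card (translates act A W)"
      using mult_left_mono[OF W(2)[OF A] c] by (simp add: mult.assoc)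
    also have "\<dots> \<le> card (translates act (translates act A W) U)"
      using A W(1) translates_subset by (intro exp finite_translates)
    finally show ?thesis by (simp add: translates_translates A)
  qed
  then show ?case using W(1) U by (intro exI[of _ "\<Union>v\<in>W. (+) v ` U"]) auto
qed

text \<open>Without almost invariant finite sets, some finite set of translations doubles every finite
  set, and the marriage theorem yields two disjoint copies of \<open>X\<close>, each of mean 1.\<close>

lemma amenable_imp_Folner:
  fixes \<epsilon> :: real
  assumes "amenable" and T: "finite T" and \<epsilon>: "\<epsilon> > 0"
  obtains (Folner) A where "finite A" "A \<subseteq> X" "A \<noteq> {}"
    "card (translates act A (insert 0 T)) < (1 + \<epsilon>) * card A"
proof (rule ccontr)
  assume no: "\<not> thesis"
  obtain \<mu> where "invariant_mean X act \<mu>" using assms(1) amenable_iff_invariant_mean by blast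
  then interpret invariant_mean X act \<mu> .
  \<comment> \<open>For nonempty \<open>A\<close> this is the failure of the claim; for empty
    \<open>A\<close> both sides are 0.\<close>
  have exp: "(1 + \<epsilon>) * card A \<le> card (translates act A (insert 0 T))"
    if A: "finite A" "A \<subseteq> X" for A
  proof (rule ccontr)
    assume "\<not> ?thesis"
    then show False using no Folner[OF A] by (cases "A = {}") (auto simp: translates_def)
  qed
  obtain n where n: "2 < (1 + \<epsilon>) ^ n" using real_arch_pow[of "1 + \<epsilon>" 2] \<epsilon> by auto
  obtain W where W: "finite W"
    and dbl: "\<And>A. finite A \<Longrightarrow> A \<subseteq> X \<Longrightarrow> (1 + \<epsilon>) ^ n * card A \<le> card (translates act A W)"
    using expansion_power[of "insert 0 T" "1 + \<epsilon>" n] T \<epsilon> exp by auto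
  \<comment> \<open>The Boolean distinguishes two copies of each point \<open>x\<close>; both are to
    be sent to points \<open>act x w\<close> with \<open>w \<in> W\<close>, all images being
    distinct.\<close>
  have "\<exists>f. inj_on f (X \<times> (UNIV :: bool set)) \<and>
      (\<forall>i\<in>X \<times> UNIV. f i \<in> (\<lambda>(x, _). translates act {x} W) i)"
  proof (rule marriage)
    show "finite ((\<lambda>(x, _). translates act {x} W) i)" for i :: "'x \<times> bool"
      using W by (cases i) (simp add: finite_translates)
  next
    fix J :: "('x \<times> bool) set" assume J: "finite J" "J \<subseteq> X \<times> UNIV"
    then have f: "finite (fst ` J)" "fst ` J \<subseteq> X" by auto
    \<comment> \<open>At most two elements of \<open>J\<close> lie over each point, and the growth
      factor above 2 compensates for this.\<close>
    have "J \<subseteq> fst ` J \<times> UNIV" by force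
    then have "card J \<le> card (fst ` J \<times> (UNIV :: bool set))" using f(1) by (intro card_mono) auto
    then have "real (card J) \<le> 2 * real (card (fst ` J))"
      by (simp add: card_cartesian_product)
    also have "\<dots> \<le> (1 + \<epsilon>) ^ n * real (card (fst ` J))"
      using n by (intro mult_right_mono) auto
    also have "\<dots> \<le> card (translates act (fst ` J) W)" by (rule dbl[OF f])
    also have "translates act (fst ` J) W = (\<Union>i\<in>J. (\<lambda>(x, _). translates act {x} W) i)"
      by (auto simp: translates_def split_beta image_iff)
    finally show "card J \<le> card (\<Union>i\<in>J. (\<lambda>(x, _). translates act {x} W) i)" by simp
  qed blast
  then obtain f where f: "inj_on f (X \<times> (UNIV :: bool set))"
    "\<And>x b. x \<in> X \<Longrightarrow> f (x, b) \<in> translates act {x} W" by fastforce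
  have one: "\<mu> ((\<lambda>x. f (x, b)) ` X) = 1" for b
  proof (rule piecewise_translation[OF W])
    show "\<exists>w\<in>W. f (x, b) = act x w" if "x \<in> X" for x
      using f(2)[OF that, of b] by (auto simp: translates_def)
    show "inj_on (\<lambda>x. f (x, b)) X" using f(1) by (auto simp: inj_on_def)
  qed
  have sub: "(\<lambda>x. f (x, b)) ` X \<subseteq> X" for b
    using f(2) translates_subset[of "{_}"] by blast
  have "(\<lambda>x. f (x, True)) ` X \<inter> (\<lambda>x. f (x, False)) ` X = {}"
    using f(1) by (auto simp: inj_on_def)
  then have "\<mu> ((\<lambda>x. f (x, True)) ` X \<union> (\<lambda>x. f (x, False)) ` X) = 2"
    using additive[OF sub sub] one by simp
  then show False using le_one[OF Un_least[OF sub sub], of True False] by simp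
qed

end

section \<open>Leading positions of a space of finitely supported functions\<close>

interpretation pm: vspace "scale_pm :: 'k::field \<Rightarrow> ('a \<Rightarrow>\<^sub>0 'k) \<Rightarrow> _"
  by (rule vspace_scale_pm)

lemma subspace_span_of: "pm.subspace (span_of X :: ('a \<Rightarrow>\<^sub>0 'k::field) set)"
proof (rule pm.subspaceI)
  show "f + g \<in> span_of X" if "f \<in> span_of X" "g \<in> span_of X" for f g :: "'a \<Rightarrow>\<^sub>0 'k"
    using that Poly_Mapping.keys_add[of f g] by (auto simp: span_of_def)
  show "scale_pm c f \<in> span_of X" if "f \<in> span_of X" for c and f :: "'a \<Rightarrow>\<^sub>0 'k"
    using that keys_scale_pm[of c f] by (auto simp: span_of_def)
qed (simp add: span_of_def)

text \<open>Positions are ordered by their ranks under \<open>\<rho>\<close>, so that permuting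
  positions changes the order by composition. The zero vector contributes nothing, its support being
  empty.\<close>

definition leading :: "('a \<Rightarrow> nat) \<Rightarrow> ('a \<Rightarrow>\<^sub>0 'k::zero) set \<Rightarrow> 'a set" where
  "leading \<rho> F = {x. \<exists>f\<in>F. x \<in> Poly_Mapping.keys f \<and> (\<forall>y\<in>Poly_Mapping.keys f. \<rho> y \<le> \<rho> x)}"

lemma leading_mono: "F \<subseteq> F' \<Longrightarrow> leading \<rho> F \<subseteq> leading \<rho> F'"
  by (auto simp: leading_def)

lemma leading_subset: "F \<subseteq> span_of Z \<Longrightarrow> leading \<rho> F \<subseteq> Z"
  by (auto simp: leading_def span_of_def)

text \<open>Only the order on a support matters. This later allows translation by a group element to
  be exchanged for a permutation that agrees with it on the support.\<close>

lemma leading_cong: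
  assumes "F \<subseteq> span_of Z" "\<And>x. x \<in> Z \<Longrightarrow> \<rho> x = \<rho>' x"
  shows "leading \<rho> F = leading \<rho>' F"
proof -
  have "(x \<in> Poly_Mapping.keys f \<and> (\<forall>y\<in>Poly_Mapping.keys f. \<rho> y \<le> \<rho> x)) \<longleftrightarrow>
      (x \<in> Poly_Mapping.keys f \<and> (\<forall>y\<in>Poly_Mapping.keys f. \<rho>' y \<le> \<rho>' x))"
    if "f \<in> F" for f x
  proof -
    have "Poly_Mapping.keys f \<subseteq> Z" using assms(1) that by (auto simp: span_of_def)
    then show ?thesis using assms(2) by (metis subsetD)
  qed
  then show ?thesis unfolding leading_def by blast
qed

text \<open>Gaussian elimination: vectors with distinct leading positions, one for each position that
  occurs, form an echelon basis.\<close>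

lemma leading_basis:
  fixes F :: "('a \<Rightarrow>\<^sub>0 'k::field) set"
  assumes F: "pm.subspace F" "F \<subseteq> span_of Z" and Z: "finite Z" and inj: "inj_on \<rho> Z"
  obtains B where "finite B" "B \<subseteq> F" "pm.independent B" "pm.span B = F"
    "card B = card (leading \<rho> F)"
proof -
  define L where "L = leading \<rho> F"
  have LZ: "L \<subseteq> Z" using leading_subset[OF F(2)] by (simp add: L_def)
  then have finL: "finite L" using Z finite_subset by blast
  have keysZ: "Poly_Mapping.keys f \<subseteq> Z" if "f \<in> F" for f
    using F(2) that by (auto simp: span_of_def)
  have "\<forall>x\<in>L. \<exists>f. f \<in> F \<and> x \<in> Poly_Mapping.keys f \<and> (\<forall>y\<in>Poly_Mapping.keys f. \<rho> y \<le> \<rho> x)"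
    by (auto simp: L_def leading_def)
  then obtain e where e: "\<forall>x\<in>L. e x \<in> F \<and> x \<in> Poly_Mapping.keys (e x) \<and>
      (\<forall>y\<in>Poly_Mapping.keys (e x). \<rho> y \<le> \<rho> x)"
    using bchoice[of L] by metis
  have inje: "inj_on e L"
  proof (rule inj_onI)
    fix x y assume xy: "x \<in> L" "y \<in> L" "e x = e y"
    then have "\<rho> x = \<rho> y" using e by (metis order_antisym)
    then show "x = y" using xy LZ inj by (auto dest: inj_onD)
  qed
  have zero: "u x = 0" if s: "(\<Sum>x\<in>L. scale_pm (u x) (e x)) = 0" and x: "x \<in> L" for u x
  proof (rule ccontr)
    assume "u x \<noteq> 0"
    then have ne: "{x \<in> L. u x \<noteq> 0} \<noteq> {}" "finite {x \<in> L. u x \<noteq> 0}" using x finL by auto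
    obtain z where z: "z \<in> L" "u z \<noteq> 0" "\<And>y. y \<in> L \<Longrightarrow> u y \<noteq> 0 \<Longrightarrow> \<rho> y \<le> \<rho> z"
      using obtains_MAX[OF ne(2,1), of \<rho>] by (metis (mono_tags, lifting) Max_ge finite_imageI
          imageI mem_Collect_eq ne(2))
    \<comment> \<open>Here \<open>z\<close> is the highest position with nonzero coefficient. If
      \<open>z\<close> were in the support of another \<open>e y\<close> with
      \<open>u y \<noteq> 0\<close>, the ranks of \<open>y\<close> and \<open>z\<close> would bound
      each other and so be equal. Thus only \<open>e z\<close> contributes to the coordinate at
      \<open>z\<close>.\<close>
    have "u y * Poly_Mapping.lookup (e y) z = 0" if y: "y \<in> L" "y \<noteq> z" for y
    proof (rule ccontr)
      assume "\<not> ?thesis"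
      then have "u y \<noteq> 0" "z \<in> Poly_Mapping.keys (e y)" by (auto simp: in_keys_iff)
      then have "\<rho> y = \<rho> z" using z(3)[OF y(1)] e y(1) by (metis order_antisym)
      then show False using y z(1) LZ inj by (auto dest: inj_onD)
    qed
    then have "(\<Sum>y\<in>L. u y * Poly_Mapping.lookup (e y) z) = u z * Poly_Mapping.lookup (e z) z"
      using finL z(1) by (subst sum.remove[of _ z]) (simp_all add: sum.neutral)
    moreover have "(\<Sum>y\<in>L. u y * Poly_Mapping.lookup (e y) z) = 0"
      using arg_cong[OF s, of "\<lambda>f. Poly_Mapping.lookup f z"] by (simp add: lookup_sum)
    ultimately show False using z e by (auto simp: in_keys_iff)
  qed
  have ind: "pm.independent (e ` L)"
  proof (rule pm.independent_if_scalars_zero)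
    fix f x assume s: "(\<Sum>x\<in>e ` L. scale_pm (f x) x) = 0" and x: "x \<in> e ` L"
    then have "(\<Sum>x\<in>L. scale_pm (f (e x)) (e x)) = 0" by (simp add: sum.reindex[OF inje])
    then show "f x = 0" using zero[of "\<lambda>x. f (e x)"] x by auto
  qed (use finL in simp)
  have eF: "e ` L \<subseteq> F" using e by auto
  \<comment> \<open>Induction on a strict bound for the ranks in the support. In the step, a
    position of rank \<open>n\<close> is the highest one, hence in \<open>L\<close>, and a multiple
    of its echelon vector cancels it.\<close>
  have red: "f \<in> F \<Longrightarrow> \<forall>y\<in>Poly_Mapping.keys f. \<rho> y < n \<Longrightarrow> f \<in> pm.span (e ` L)" for n f
  proof (induction n arbitrary: f)
    case 0
    then have "f = 0" by simp
    then show ?case using pm.span_zero by simp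
  next
    case (Suc n)
    show ?case
    proof (cases "\<exists>x\<in>Poly_Mapping.keys f. \<rho> x = n")
      case False
      then have "\<forall>y\<in>Poly_Mapping.keys f. \<rho> y < n" using Suc.prems(2) less_antisym by blast
      then show ?thesis using Suc by blast
    next
      case True
      then obtain x where x: "x \<in> Poly_Mapping.keys f" "\<rho> x = n" by blast
      then have "\<forall>y\<in>Poly_Mapping.keys f. \<rho> y \<le> \<rho> x" using Suc.prems(2) by (simp add: less_Suc_eq_le)
      then have xL: "x \<in> L" using x(1) Suc.prems(1) by (auto simp: L_def leading_def)
      define c where "c = Poly_Mapping.lookup f x / Poly_Mapping.lookup (e x) x"
      define f' where "f' = f - scale_pm c (e x)"
      have "f' \<in> F" unfolding f'_def using e xL Suc.prems(1)
        by (intro pm.subspace_diff[OF F(1)] pm.subspace_scale[OF F(1)]) auto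
      moreover have "\<rho> y < n" if y: "y \<in> Poly_Mapping.keys f'" for y
      proof -
        \<comment> \<open>The coefficient at \<open>x\<close> cancels, and by injectivity no other
          position of \<open>Z\<close> has rank \<open>n\<close>.\<close>
        have "Poly_Mapping.lookup f' x = 0"
          using e xL by (auto simp: f'_def c_def lookup_minus in_keys_iff)
        then have "y \<noteq> x" using y by (auto simp: in_keys_iff)
        moreover have yy: "y \<in> Poly_Mapping.keys f \<or> y \<in> Poly_Mapping.keys (e x)"
          using y by (auto simp: f'_def lookup_minus in_keys_iff)
        then have "\<rho> y \<le> n" using Suc.prems(2) e xL x(2) by (auto simp: less_Suc_eq_le)
        moreover have "y \<in> Z" using yy keysZ Suc.prems(1) e xL by blast
        ultimately show ?thesis using inj x xL LZ by (metis inj_onD le_neq_implies_less subsetD)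
      qed
      ultimately have "f' \<in> pm.span (e ` L)" using Suc.IH by blast
      moreover have "scale_pm c (e x) \<in> pm.span (e ` L)"
        using xL by (intro pm.span_scale pm.span_base) auto
      ultimately have "f' + scale_pm c (e x) \<in> pm.span (e ` L)" by (rule pm.span_add)
      then show ?thesis by (simp add: f'_def)
    qed
  qed
  have "pm.span (e ` L) = F"
  proof
    show "pm.span (e ` L) \<subseteq> F" by (rule pm.span_minimal[OF eF F(1)])
    show "F \<subseteq> pm.span (e ` L)"
    proof
      fix f assume "f \<in> F"
      moreover obtain n where "\<forall>y\<in>\<rho> ` Poly_Mapping.keys f. y < n"
        using finite_nat_set_iff_bounded[of "\<rho> ` Poly_Mapping.keys f"] by auto
      ultimately show "f \<in> pm.span (e ` L)" using red[of f n] by blast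
    qed
  qed
  then show thesis
    using that[of "e ` L"] finL eF ind card_image[OF inje] by (simp add: L_def)
qed

text \<open>The echelon basis has one vector per leading position, so their number is the same for
  every order.\<close>

lemma card_leading:
  fixes F :: "('a \<Rightarrow>\<^sub>0 'k::field) set"
  assumes "pm.subspace F" "F \<subseteq> span_of Z" "finite Z" "inj_on \<rho> Z"
  shows "card (leading \<rho> F) = pm.dim F"
proof -
  obtain B where "pm.independent B" "pm.span B = F" "card B = card (leading \<rho> F)"
    using leading_basis[OF assms] by metis
  then show ?thesis using pm.dim_eq_card_independent pm.dim_span by metis
qed

text \<open>Finitely many spanning vectors involve finitely many positions; conversely, an echelon
  basis is a finite spanning set.\<close>

lemma fin_dim_subspace_iff:
  fixes F :: "('a \<Rightarrow>\<^sub>0 'k::field) set"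
  assumes "F \<subseteq> span_of X"
  shows "pm.fin_dim_subspace F \<longleftrightarrow> pm.subspace F \<and> (\<exists>Z. finite Z \<and> Z \<subseteq> X \<and> F \<subseteq> span_of Z)"
proof
  assume "pm.fin_dim_subspace F"
  then obtain B where F: "pm.subspace F" and B: "finite B" "pm.span B = F"
    by (auto simp: pm.fin_dim_subspace_def)
  define Z where "Z = (\<Union>f\<in>B. Poly_Mapping.keys f)"
  have "B \<subseteq> F" using B pm.span_superset by blast
  then have "Z \<subseteq> X" using assms by (auto simp: Z_def span_of_def)
  moreover have "B \<subseteq> span_of Z" by (auto simp: Z_def span_of_def)
  then have "F \<subseteq> span_of Z" using B(2) pm.span_minimal[OF _ subspace_span_of] by blast
  moreover have "finite Z" using B(1) by (simp add: Z_def)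
  ultimately show "pm.subspace F \<and> (\<exists>Z. finite Z \<and> Z \<subseteq> X \<and> F \<subseteq> span_of Z)"
    using F by blast
next
  assume "pm.subspace F \<and> (\<exists>Z. finite Z \<and> Z \<subseteq> X \<and> F \<subseteq> span_of Z)"
  then obtain Z where F: "pm.subspace F" and Z: "finite Z" "F \<subseteq> span_of Z" by blast
  obtain \<rho> :: "'a \<Rightarrow> nat" where "inj_on \<rho> Z" using finite_imp_inj_to_nat_seg[OF Z(1)] by blast
  then show "pm.fin_dim_subspace F"
    using leading_basis[OF F Z(2,1)] F unfolding pm.fin_dim_subspace_def by metis
qed

lemma dim_span_of:
  assumes "finite Z"
  shows "pm.dim (span_of Z :: ('a \<Rightarrow>\<^sub>0 'k::field) set) = card Z"
proof -
  obtain \<rho> :: "'a \<Rightarrow> nat" where \<rho>: "inj_on \<rho> Z"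
    using finite_imp_inj_to_nat_seg[OF assms] by blast
  \<comment> \<open>The unit vector at \<open>x\<close> makes \<open>x\<close> leading, whatever the
    order.\<close>
  have "x \<in> leading \<rho> (span_of Z :: ('a \<Rightarrow>\<^sub>0 'k) set)" if "x \<in> Z" for x
    using that unfolding leading_def span_of_def
    by (intro CollectI bexI[of _ "Poly_Mapping.single x 1"]) auto
  then have "leading \<rho> (span_of Z :: ('a \<Rightarrow>\<^sub>0 'k) set) = Z"
    by (intro subset_antisym[OF leading_subset[OF order_refl]] subsetI)
  then show ?thesis
    using card_leading[OF subspace_span_of order_refl assms \<rho>, where 'k='k] by simp
qed

lemma fin_dim_subspace_span_of:
  "finite Z \<Longrightarrow> pm.fin_dim_subspace (span_of Z :: ('a \<Rightarrow>\<^sub>0 'k::field) set)"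
  unfolding fin_dim_subspace_iff[OF order_refl] by (auto intro: subspace_span_of)

text \<open>\<open>F\<close> is an arbitrary subset here, so the bound comes from an echelon basis
  of all of \<open>span_of Z\<close>, whose size is at most \<open>card Z\<close>.\<close>

lemma dim_le_card_support:
  fixes F :: "('a \<Rightarrow>\<^sub>0 'k::field) set"
  assumes "F \<subseteq> span_of Z" "finite Z"
  shows "pm.dim F \<le> card Z"
proof -
  obtain \<rho> :: "'a \<Rightarrow> nat" where \<rho>: "inj_on \<rho> Z"
    using finite_imp_inj_to_nat_seg[OF assms(2)] by blast
  obtain B where B: "finite B" "pm.span B = (span_of Z :: ('a \<Rightarrow>\<^sub>0 'k) set)"
    "card B = card (leading \<rho> (span_of Z :: ('a \<Rightarrow>\<^sub>0 'k) set))"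
    using leading_basis[OF subspace_span_of order_refl assms(2) \<rho>] by metis
  then have "pm.dim F \<le> card B" using assms(1) by (intro pm.dim_le_card) auto
  also have "\<dots> \<le> card Z"
    unfolding B(3) by (rule card_mono[OF assms(2) leading_subset[OF order_refl]])
  finally show ?thesis .
qed

section \<open>Amenable sets have amenable spans\<close>

lemma keys_linear_act:
  "Poly_Mapping.keys (linear_act act f a)
    \<subseteq> translates act (Poly_Mapping.keys f) (Poly_Mapping.keys a)"
proof
  fix y assume "y \<in> Poly_Mapping.keys (linear_act act f a)"
  then have "Poly_Mapping.lookup (linear_act act f a) y \<noteq> 0" by (simp add: in_keys_iff)
  then have "(\<Sum>x\<in>Poly_Mapping.keys f. \<Sum>g\<in>Poly_Mapping.keys a. Poly_Mapping.lookup
      (Poly_Mapping.single (act x g) (Poly_Mapping.lookup f x * Poly_Mapping.lookup a g)) y) \<noteq> 0"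
    by (simp add: linear_act_def lookup_sum)
  then obtain x where x: "x \<in> Poly_Mapping.keys f" "(\<Sum>g\<in>Poly_Mapping.keys a. Poly_Mapping.lookup
      (Poly_Mapping.single (act x g) (Poly_Mapping.lookup f x * Poly_Mapping.lookup a g)) y) \<noteq> 0"
    by (meson sum.not_neutral_contains_not_neutral)
  then obtain g where "g \<in> Poly_Mapping.keys a" "Poly_Mapping.lookup
      (Poly_Mapping.single (act x g) (Poly_Mapping.lookup f x * Poly_Mapping.lookup a g)) y \<noteq> 0"
    by (meson sum.not_neutral_contains_not_neutral)
  then show "y \<in> translates act (Poly_Mapping.keys f) (Poly_Mapping.keys a)"
    using x(1) by (auto simp: translates_def lookup_single when_def split: if_splits)
qed

section \<open>The subspace \<open>F + Fs\<close> of a right module\<close>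

context right_module
begin

lemma act_zero_left: "act 0 s = 0"
  using act_add_left[OF A.subspace_0[OF subspace_M] A.subspace_0[OF subspace_M], of s] by simp

lemma subspace_translate_sum:
  assumes F: "A.subspace F" "F \<subseteq> M"
  shows "A.subspace (translate_sum F s)"
proof (rule A.subspaceI)
  show "0 \<in> translate_sum F s"
    using A.subspace_0[OF F(1)] act_zero_left[of s] unfolding translate_sum_def
    by (intro CollectI exI[of _ 0]) simp
next
  fix x y assume "x \<in> translate_sum F s" "y \<in> translate_sum F s"
  then obtain u v u' v' where "x = u + act v s" "y = u' + act v' s"
    and uv: "u \<in> F" "v \<in> F" "u' \<in> F" "v' \<in> F" by (auto simp: translate_sum_def)
  moreover have "act (v + v') s = act v s + act v' s" using uv F(2) by (intro act_add_left) auto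
  ultimately have "x + y = (u + u') + act (v + v') s" by (simp add: algebra_simps)
  then show "x + y \<in> translate_sum F s"
    using A.subspace_add[OF F(1)] uv unfolding translate_sum_def by blast
next
  fix c x assume "x \<in> translate_sum F s"
  then obtain u v where "x = u + act v s" and uv: "u \<in> F" "v \<in> F"
    by (auto simp: translate_sum_def)
  moreover have "act (sM c v) s = sM c (act v s)" using uv F(2) by (intro act_scale_left) auto
  ultimately have "sM c x = sM c u + act (sM c v) s" by (simp add: A.scale_right_distrib)
  then show "sM c x \<in> translate_sum F s"
    using A.subspace_scale[OF F(1)] uv unfolding translate_sum_def by blast
qed

lemma subset_translate_sum:
  assumes "A.subspace F"
  shows "F \<subseteq> translate_sum F s"
proof
  fix u assume "u \<in> F"
  then have "u = u + act 0 s \<and> u \<in> F \<and> 0 \<in> F"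
    using A.subspace_0[OF assms] act_zero_left[of s] by simp
  then show "u \<in> translate_sum F s" unfolding translate_sum_def by blast
qed

lemma image_subset_translate_sum:
  assumes "A.subspace F"
  shows "(\<lambda>v. act v s) ` F \<subseteq> translate_sum F s"
proof
  fix w assume "w \<in> (\<lambda>v. act v s) ` F"
  then obtain v where "w = 0 + act v s \<and> 0 \<in> F \<and> v \<in> F" using A.subspace_0[OF assms] by auto
  then show "w \<in> translate_sum F s" unfolding translate_sum_def by blast
qed

end

context right_gset
begin

text \<open>In \<open>insert 0 T\<close>, the neutral element accounts for the summand
  \<open>F\<close> and the elements of \<open>T\<close> for \<open>Fs\<close>.\<close>

lemma translate_sum_subset:
  fixes F :: "('x \<Rightarrow>\<^sub>0 'k::field) set" and s :: "'g \<Rightarrow>\<^sub>0 'k"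
  assumes F: "F \<subseteq> span_of A" and A: "A \<subseteq> X" and s: "Poly_Mapping.keys s \<subseteq> T"
  shows "right_module.translate_sum (linear_act act) F s \<subseteq> span_of (translates act A (insert 0 T))"
proof
  interpret M: right_module scale_pm "scale_pm :: 'k \<Rightarrow> ('x \<Rightarrow>\<^sub>0 'k) \<Rightarrow> _" "span_of X" "linear_act act"
    by (rule right_module_span_of)
  fix w assume "w \<in> M.translate_sum F s"
  then obtain u v where w: "w = u + linear_act act v s" "u \<in> F" "v \<in> F"
    by (auto simp: M.translate_sum_def)
  have "u \<in> span_of (translates act A (insert 0 T))"
    using F w(2) subset_translates[OF A, of "insert 0 T"] by (auto simp: span_of_def)
  moreover have "Poly_Mapping.keys v \<subseteq> A" using F w(3) by (auto simp: span_of_def)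
  then have "translates act (Poly_Mapping.keys v) (Poly_Mapping.keys s)
      \<subseteq> translates act A (insert 0 T)"
    using s by (auto simp: translates_def)
  then have "linear_act act v s \<in> span_of (translates act A (insert 0 T))"
    using keys_linear_act[of act v s] by (auto simp: span_of_def)
  ultimately show "w \<in> span_of (translates act A (insert 0 T))"
    unfolding w(1) by (rule pm.subspace_add[OF subspace_span_of])
qed

text \<open>Let \<open>F\<close> be the span of a Folner set \<open>A\<close>. Then
  \<open>F + Fs\<close> is supported on the translates of \<open>A\<close>, so its dimension exceeds
  \<open>card A\<close> by less than \<open>\<epsilon> * card A\<close>.\<close>

lemma amenable_imp_module_amenable:
  assumes amenable
  shows "right_module.amenable (scale_pm :: 'k::field \<Rightarrow> ('g \<Rightarrow>\<^sub>0 'k) \<Rightarrow> _)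
    (scale_pm :: 'k \<Rightarrow> ('x \<Rightarrow>\<^sub>0 'k) \<Rightarrow> _) (span_of X) (linear_act act)"
proof -
  interpret M: right_module "scale_pm :: 'k \<Rightarrow> ('g \<Rightarrow>\<^sub>0 'k) \<Rightarrow> _"
    "scale_pm :: 'k \<Rightarrow> ('x \<Rightarrow>\<^sub>0 'k) \<Rightarrow> _" "span_of X" "linear_act act"
    by (rule right_module_span_of)
  show ?thesis
    unfolding M.amenable_def
  proof (intro allI impI, elim conjE)
    fix \<epsilon> :: real and S :: "('g \<Rightarrow>\<^sub>0 'k) set"
    assume \<epsilon>: "\<epsilon> > 0" and "pm.fin_dim_subspace S"
    \<comment> \<open>One finite \<open>T\<close> supports all of \<open>S\<close>, so a single
      Folner set serves every \<open>s \<in> S\<close>.\<close>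
    then obtain T where T: "finite T" "S \<subseteq> span_of T"
      using fin_dim_subspace_iff[of S UNIV] by (auto simp: span_of_def)
    obtain A where A: "finite A" "A \<subseteq> X" "A \<noteq> {}"
      and small: "card (translates act A (insert 0 T)) < (1 + \<epsilon>) * card A"
      using amenable_imp_Folner[OF assms T(1) \<epsilon>] by blast
    define F where "F = (span_of A :: ('x \<Rightarrow>\<^sub>0 'k) set)"
    have F: "pm.subspace F" "F \<subseteq> span_of X" "pm.fin_dim_subspace F" "pm.dim F = card A"
      using A subspace_span_of[of A] fin_dim_subspace_span_of[OF A(1)] dim_span_of[OF A(1)]
      by (auto simp: F_def span_of_def)
    obtain x where "x \<in> A" using A(3) by blast
    then have "Poly_Mapping.single x 1 \<in> F" by (simp add: F_def span_of_def)
    moreover have "Poly_Mapping.lookup (Poly_Mapping.single x (1::'k)) x \<noteq> 0" by simp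
    ultimately have "F \<noteq> {0}" by force
    moreover have "real (pm.quotient_dim (M.translate_sum F s) F) / real (pm.dim F) < \<epsilon>"
      if "s \<in> S" for s
    proof -
      let ?E = "M.translate_sum F s" and ?Y = "translates act A (insert 0 T)"
      have s: "Poly_Mapping.keys s \<subseteq> T" using that T(2) by (auto simp: span_of_def)
      have E: "?E \<subseteq> span_of ?Y"
        using translate_sum_subset[OF order_refl A(2) s] by (simp add: F_def)
      have Y: "finite ?Y" using A(1) T(1) by (simp add: finite_translates)
      have "pm.subspace ?E" by (rule M.subspace_translate_sum[OF F(1,2)])
      then have "pm.fin_dim_subspace ?E" using fin_dim_subspace_iff[OF E] E Y by blast
      then have "pm.quotient_dim ?E F + pm.dim F = pm.dim ?E"
        by (rule pm.quotient_dim_eq[OF _ F(1) M.subset_translate_sum[OF F(1)]])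
      also have "\<dots> \<le> card ?Y" by (rule dim_le_card_support[OF E Y])
      finally have "real (pm.quotient_dim ?E F) + card A \<le> card ?Y" using F(4) by linarith
      then have "real (pm.quotient_dim ?E F) < \<epsilon> * card A"
        using small by (simp add: algebra_simps)
      moreover have "card A > 0" using A by (simp add: card_gt_0_iff)
      ultimately show ?thesis by (simp add: F(4) divide_less_eq)
    qed
    ultimately show "\<exists>F\<subseteq>span_of X. pm.fin_dim_subspace F \<and> F \<noteq> {0} \<and>
        (\<forall>s\<in>S. real (pm.quotient_dim (M.translate_sum F s) F) / real (pm.dim F) < \<epsilon>)"
      using F by blast
  qed
qed

end

section \<open>Invariant means from almost invariant subspaces\<close>

text \<open>Within the finite set \<open>Z\<close>, the complements of \<open>Y\<close> and of its
  image have equally many elements; any bijection between them completes \<open>f\<close>.\<close>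

lemma extend_to_permutation:
  assumes Z: "finite Z" "Y \<subseteq> Z" and f: "inj_on f Y" "f ` Y \<subseteq> Z"
  obtains \<sigma> where "\<sigma> permutes Z" "\<And>y. y \<in> Y \<Longrightarrow> \<sigma> y = f y"
proof -
  have "card (Z - Y) = card (Z - f ` Y)"
    using Z f card_image[OF f(1)] finite_subset[OF Z(2,1)] by (simp add: card_Diff_subset)
  then obtain \<beta> where \<beta>: "bij_betw \<beta> (Z - Y) (Z - f ` Y)"
    using finite_same_card_bij[of "Z - Y" "Z - f ` Y"] Z(1) by auto
  define \<sigma> where "\<sigma> z = (if z \<in> Y then f z else if z \<in> Z then \<beta> z else z)" for z
  have "bij_betw \<sigma> Y (f ` Y)"
    using f(1) by (subst bij_betw_cong[of _ _ f]) (auto simp: \<sigma>_def bij_betw_def)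
  moreover have "bij_betw \<sigma> (Z - Y) (Z - f ` Y)"
    using \<beta> by (subst bij_betw_cong[of _ _ \<beta>]) (auto simp: \<sigma>_def)
  ultimately have "bij_betw \<sigma> (Y \<union> (Z - Y)) (f ` Y \<union> (Z - f ` Y))"
    by (rule bij_betw_combine) auto
  then have "bij_betw \<sigma> Z Z" using Z(2) f(2) by (simp add: Un_absorb1 Un_Diff_cancel)
  then have "\<sigma> permutes Z" using Z(2) by (intro bij_imp_permutes) (auto simp: \<sigma>_def)
  then show thesis by (rule that) (simp add: \<sigma>_def)
qed

text \<open>Right composition with \<open>\<sigma>\<close> is a bijection of the symmetric group of
  \<open>Z\<close>. It will absorb the change of order caused by a translation.\<close>

lemma sum_permutations_compose:
  assumes "\<sigma> permutes Z"
  shows "(\<Sum>\<pi> | \<pi> permutes Z. F (\<pi> \<circ> \<sigma>)) = (\<Sum>\<pi> | \<pi> permutes Z. F \<pi>)"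
  by (rule sum.reindex_bij_witness[of _ "\<lambda>\<pi>. \<pi> \<circ> inv \<sigma>" "\<lambda>\<pi>. \<pi> \<circ> \<sigma>"])
    (use assms in \<open>auto simp: comp_assoc permutes_inv_o intro: permutes_compose permutes_inv\<close>)

text \<open>Enlarging \<open>L\<close> to \<open>L'\<close> adds to the count in \<open>B\<close> at
  most the number of new elements. The second bound is written so as to avoid subtraction of natural
  numbers.\<close>

lemma card_Int_bounds:
  assumes "L \<subseteq> L'" "finite L'"
  shows "card (L \<inter> B) \<le> card (L' \<inter> B)" "card (L' \<inter> B) + card L \<le> card (L \<inter> B) + card L'"
proof -
  show "card (L \<inter> B) \<le> card (L' \<inter> B)" using assms by (intro card_mono) auto
  have "card (L' \<inter> B) \<le> card ((L \<inter> B) \<union> (L' - L))" using assms by (intro card_mono) (auto intro: finite_subset)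
  also have "\<dots> \<le> card (L \<inter> B) + card (L' - L)" by (rule card_Un_le)
  also have "card (L' - L) = card L' - card L" using assms by (intro card_Diff_subset) (auto intro: finite_subset)
  finally show "card (L' \<inter> B) + card L \<le> card (L \<inter> B) + card L'"
    using card_mono[OF assms(2,1)] by linarith
qed

section \<open>Equivariance of supports and leading positions\<close>

context right_gset
begin

text \<open>The inclusion from left to right is general. Applied to the translate of
  \<open>f\<close> and to \<open>- g\<close>, which brings back \<open>f\<close>, it yields the
  other inclusion.\<close>

lemma keys_linear_act_single:
  fixes f :: "'x \<Rightarrow>\<^sub>0 'k::field"
  assumes f: "f \<in> span_of X"
  shows "Poly_Mapping.keys (linear_act act f (Poly_Mapping.single g 1))
    = (\<lambda>x. act x g) ` Poly_Mapping.keys f"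
proof
  have *: "Poly_Mapping.keys (linear_act act f (Poly_Mapping.single g 1))
      \<subseteq> (\<lambda>x. act x g) ` Poly_Mapping.keys f" for f :: "'x \<Rightarrow>\<^sub>0 'k" and g
    using keys_linear_act[of act f "Poly_Mapping.single g 1"] by (auto simp: translates_def)
  show "Poly_Mapping.keys (linear_act act f (Poly_Mapping.single g 1))
      \<subseteq> (\<lambda>x. act x g) ` Poly_Mapping.keys f" by (rule *)
  let ?f' = "linear_act act f (Poly_Mapping.single g 1)"
  have "linear_act act ?f' (Poly_Mapping.single (- g) 1) = f"
    using linear_act_mult[OF f, of "Poly_Mapping.single g 1" "Poly_Mapping.single (- g) 1"]
      linear_act_one[OF f] by (simp add: mult_single)
  then have inv: "Poly_Mapping.keys f \<subseteq> (\<lambda>x. act x (- g)) ` Poly_Mapping.keys ?f'"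
    using *[of ?f' "- g"] by simp
  have "Poly_Mapping.keys ?f' \<subseteq> X" using *[of f g] f closed by (auto simp: span_of_def)
  then have "act (act y (- g)) g = y" if "y \<in> Poly_Mapping.keys ?f'" for y
    using that act_add[of y "- g" g] act_zero[of y] by auto
  then show "(\<lambda>x. act x g) ` Poly_Mapping.keys f \<subseteq> Poly_Mapping.keys ?f'"
    using inv by auto
qed

text \<open>Supports of translates are translates of supports, so comparing ranks there amounts to
  comparing ranks pulled back along \<open>g\<close>.\<close>

lemma leading_image:
  fixes F :: "('x \<Rightarrow>\<^sub>0 'k::field) set"
  assumes "F \<subseteq> span_of X"
  shows "leading \<rho> ((\<lambda>f. linear_act act f (Poly_Mapping.single g 1)) ` F)
    = (\<lambda>x. act x g) ` leading (\<lambda>x. \<rho> (act x g)) F"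
proof -
  have keys: "Poly_Mapping.keys (linear_act act f (Poly_Mapping.single g 1))
      = (\<lambda>x. act x g) ` Poly_Mapping.keys f" if "f \<in> F" for f
    using that assms by (intro keys_linear_act_single) blast
  have "leading \<rho> ((\<lambda>f. linear_act act f (Poly_Mapping.single g 1)) ` F)
      = {x. \<exists>f\<in>F. x \<in> (\<lambda>x. act x g) ` Poly_Mapping.keys f \<and>
          (\<forall>y\<in>(\<lambda>x. act x g) ` Poly_Mapping.keys f. \<rho> y \<le> \<rho> x)}"
    unfolding leading_def using keys by simp
  then show ?thesis unfolding leading_def by auto
qed

text \<open>The finite set \<open>Z\<close> contains the translates of a support \<open>Y\<close> of \<open>F\<close>, so that on \<open>Y\<close> each
  \<open>g \<in> T\<close> acts as a permutation of \<open>Z\<close>, and averaging over the orders of \<open>Z\<close> suffices. Both \<open>F\<close>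
  and \<open>Fg\<close> lie in \<open>F + Fg\<close>, whose set of leading positions is only slightly larger.\<close>

lemma module_amenable_imp_almost_invariant:
  fixes \<epsilon> :: real
  assumes am: "right_module.amenable (scale_pm :: 'k::field \<Rightarrow> ('g \<Rightarrow>\<^sub>0 'k) \<Rightarrow> _)
      (scale_pm :: 'k \<Rightarrow> ('x \<Rightarrow>\<^sub>0 'k) \<Rightarrow> _) (span_of X) (linear_act act)"
    and T: "finite T" and \<epsilon>: "\<epsilon> > 0"
  obtains \<mu> :: "'x set \<Rightarrow> real" where "\<And>A. 0 \<le> \<mu> A" "\<And>A. \<mu> A \<le> 1" "\<mu> X = 1"
    "\<And>A B. A \<inter> B = {} \<Longrightarrow> \<mu> (A \<union> B) = \<mu> A + \<mu> B"
    "\<And>A g. A \<subseteq> X \<Longrightarrow> g \<in> T \<Longrightarrow> \<bar>\<mu> ((\<lambda>x. act x g) ` A) - \<mu> A\<bar> \<le> \<epsilon>"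
proof -
  interpret M: right_module "scale_pm :: 'k \<Rightarrow> ('g \<Rightarrow>\<^sub>0 'k) \<Rightarrow> _"
    "scale_pm :: 'k \<Rightarrow> ('x \<Rightarrow>\<^sub>0 'k) \<Rightarrow> _" "span_of X" "linear_act act"
    by (rule right_module_span_of)
  \<comment> \<open>This space contains the unit vector of every \<open>g \<in> T\<close>, so one
    \<open>F\<close> serves all of them.\<close>
  have "pm.fin_dim_subspace (span_of T :: ('g \<Rightarrow>\<^sub>0 'k) set)"
    by (rule fin_dim_subspace_span_of[OF T])
  then obtain F :: "('x \<Rightarrow>\<^sub>0 'k) set" where FX: "F \<subseteq> span_of X" and "pm.fin_dim_subspace F"
    and F0: "F \<noteq> {0}"
    and quot: "\<And>s. s \<in> span_of T \<Longrightarrow>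
      real (pm.quotient_dim (M.translate_sum F s) F) / real (pm.dim F) < \<epsilon>"
    using am \<epsilon> unfolding M.amenable_def by metis
  then obtain Y where F: "pm.subspace F" and Y: "finite Y" "Y \<subseteq> X" "F \<subseteq> span_of Y"
    using fin_dim_subspace_iff[OF FX] by blast
  define Z where "Z = translates act Y (insert 0 T)"
  have Z: "finite Z" "Z \<subseteq> X" "Y \<subseteq> Z"
    unfolding Z_def using Y T by (simp_all add: finite_translates translates_subset subset_translates)
  have FZ: "F \<subseteq> span_of Z" using Y(3) Z(3) by (auto simp: span_of_def)
  obtain h :: "'x \<Rightarrow> nat" where h: "inj_on h Z" using finite_imp_inj_to_nat_seg[OF Z(1)] by blast
  \<comment> \<open>As \<open>\<pi>\<close> runs through \<open>P\<close>, the rank functions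
    \<open>h \<circ> \<pi>\<close> run through all linear orders of \<open>Z\<close>.\<close>
  define P where "P = {\<pi>. \<pi> permutes Z}"
  have injh: "inj_on (h \<circ> \<pi>) Z" if "\<pi> \<in> P" for \<pi>
    using that h by (intro comp_inj_on) (auto simp: P_def permutes_inj_on permutes_image)
  define N d where "N = real (card P)" and "d = real (pm.dim F)"
  have P: "finite P" "id \<in> P" using finite_permutations[OF Z(1)] by (auto simp: P_def permutes_id)
  then have N: "N > 0" by (auto simp: N_def card_gt_0_iff)
  have cardL: "card (leading (h \<circ> \<pi>) F) = pm.dim F" if "\<pi> \<in> P" for \<pi>
    by (rule card_leading[OF F FZ Z(1) injh[OF that]])
  have finL: "finite (leading (h \<circ> \<pi>) F)" for \<pi>
    using leading_subset[OF FZ] Z(1) finite_subset by blast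
  \<comment> \<open>In dimension 0 the echelon basis would be empty and \<open>F\<close> would be
    \<open>{0}\<close>.\<close>
  have d: "d > 0"
  proof (rule ccontr)
    assume "\<not> d > 0"
    then have "leading (h \<circ> id) F = {}" using cardL[OF P(2)] finL[of id] by (simp add: d_def)
    moreover obtain B where "pm.span B = F" "card B = card (leading (h \<circ> id) F)" "finite B"
      using leading_basis[OF F FZ Z(1) injh[OF P(2)]] by metis
    ultimately show False using F0 by simp
  qed
  \<comment> \<open>After division by \<open>N * d\<close>, \<open>c F A\<close> is the probability
    that a uniformly random leading position of \<open>F\<close>, for a uniformly random order, lies
    in \<open>A\<close>.\<close>
  define c where "c F' A = (\<Sum>\<pi>\<in>P. real (card (leading (h \<circ> \<pi>) F' \<inter> A)))"
    for F' :: "('x \<Rightarrow>\<^sub>0 'k) set" and A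
  define \<mu> where "\<mu> A = c F A / (N * d)" for A
  have c_le: "c F A \<le> N * d" for A
  proof -
    have "c F A \<le> (\<Sum>\<pi>\<in>P. d)"
      unfolding c_def
    proof (rule sum_mono)
      fix \<pi> assume "\<pi> \<in> P"
      then show "real (card (leading (h \<circ> \<pi>) F \<inter> A)) \<le> d"
        using cardL card_mono[OF finL, of "leading (h \<circ> \<pi>) F \<inter> A" \<pi>] by (simp add: d_def)
    qed
    then show ?thesis by (simp add: N_def)
  qed
  have c_total: "c F X = N * d"
  proof -
    have "leading (h \<circ> \<pi>) F \<inter> X = leading (h \<circ> \<pi>) F" for \<pi> using leading_subset[OF FX] by blast
    then have "c F X = (\<Sum>\<pi>\<in>P. d)" unfolding c_def by (intro sum.cong) (auto simp: cardL d_def)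
    then show ?thesis by (simp add: N_def)
  qed
  have c_add: "c F (A \<union> B) = c F A + c F B" if "A \<inter> B = {}" for A B
  proof -
    have "card (leading (h \<circ> \<pi>) F \<inter> (A \<union> B))
        = card (leading (h \<circ> \<pi>) F \<inter> A) + card (leading (h \<circ> \<pi>) F \<inter> B)" for \<pi>
      unfolding Int_Un_distrib using that finL[of \<pi>] by (intro card_Un_disjoint) auto
    then show ?thesis by (simp add: c_def sum.distrib)
  qed
  have c_inv: "\<bar>c F ((\<lambda>x. act x g) ` A) - c F A\<bar> \<le> N * (\<epsilon> * d)" if A: "A \<subseteq> X" and g: "g \<in> T" for A g
  proof -
    define s where "s = (Poly_Mapping.single g 1 :: 'g \<Rightarrow>\<^sub>0 'k)"
    define E Fg where "E = M.translate_sum F s" and "Fg = (\<lambda>f. linear_act act f s) ` F"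
    define q where "q = real (pm.quotient_dim E F)"
    let ?gA = "(\<lambda>x. act x g) ` A"
    have s: "Poly_Mapping.keys s \<subseteq> T" using g by (simp add: s_def)
    have E: "pm.subspace E" "F \<subseteq> E" "Fg \<subseteq> E" "E \<subseteq> span_of Z"
      unfolding E_def Fg_def Z_def using FX F translate_sum_subset[OF Y(3,2) s]
      by (auto intro: M.subspace_translate_sum M.subset_translate_sum[THEN subsetD]
          M.image_subset_translate_sum[THEN subsetD])
    then have "pm.fin_dim_subspace E" using fin_dim_subspace_iff[OF E(4)] Z(1) by blast
    then have "pm.quotient_dim E F + pm.dim F = pm.dim E"
      by (rule pm.quotient_dim_eq[OF _ F E(2)])
    then have dimE: "real (pm.dim E) = q + d" unfolding q_def d_def by linarith
    have q: "q \<le> \<epsilon> * d"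
      using quot[of s] s d by (simp add: span_of_def q_def d_def E_def divide_less_eq)
    have gY: "(\<lambda>x. act x g) ` Y \<subseteq> Z" using g by (auto simp: Z_def translates_def)
    have ginj: "inj_on (\<lambda>x. act x g) Y" using inj_on_act Y(2) inj_on_subset by blast
    obtain \<sigma> where \<sigma>: "\<sigma> permutes Z" "\<And>y. y \<in> Y \<Longrightarrow> \<sigma> y = act y g"
      using extend_to_permutation[OF Z(1,3) ginj gY] by blast
    \<comment> \<open>Since \<open>\<sigma>\<close> agrees with \<open>g\<close> on the support
      \<open>Y\<close>, pulling the order back along \<open>g\<close> becomes right composition with
      \<open>\<sigma>\<close>.\<close>
    have lead: "leading (h \<circ> \<pi>) Fg = (\<lambda>x. act x g) ` leading (h \<circ> (\<pi> \<circ> \<sigma>)) F" for \<pi>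
    proof -
      have "leading (h \<circ> \<pi>) Fg = (\<lambda>x. act x g) ` leading (\<lambda>x. (h \<circ> \<pi>) (act x g)) F"
        unfolding Fg_def s_def by (rule leading_image[OF FX])
      also have "leading (\<lambda>x. (h \<circ> \<pi>) (act x g)) F = leading (h \<circ> (\<pi> \<circ> \<sigma>)) F"
        by (rule leading_cong[OF Y(3)]) (simp add: \<sigma>(2))
      finally show ?thesis .
    qed
    have sub: "leading (h \<circ> \<pi>) F \<subseteq> X" for \<pi> by (rule leading_subset[OF FX])
    \<comment> \<open>For a single order the two counts may differ, but in the sum over all orders
      \<open>\<pi> \<circ> \<sigma>\<close> ranges over \<open>P\<close> again.\<close>
    have shift: "c Fg ?gA = c F A"
    proof -
      have "card (leading (h \<circ> \<pi>) Fg \<inter> ?gA) = card (leading (h \<circ> (\<pi> \<circ> \<sigma>)) F \<inter> A)" for \<pi>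
        unfolding lead inj_on_image_Int[OF inj_on_act sub A, symmetric]
        by (rule card_image, rule inj_on_subset[OF inj_on_act]) (use A in blast)
      then show ?thesis
        using sum_permutations_compose[OF \<sigma>(1), of "\<lambda>\<pi>. real (card (leading (h \<circ> \<pi>) F \<inter> A))"]
        by (simp add: c_def P_def)
    qed
    \<comment> \<open>Both leading sets have size \<open>d\<close> and lie in that of
      \<open>E\<close>, which has size \<open>q + d\<close>. So each count in \<open>?gA\<close>
      falls short of the count for \<open>E\<close> by at most \<open>q\<close>.\<close>
    have bound: "\<bar>real (card (leading (h \<circ> \<pi>) F \<inter> ?gA)) - real (card (leading (h \<circ> \<pi>) Fg \<inter> ?gA))\<bar> \<le> q"
      if \<pi>: "\<pi> \<in> P" for \<pi>
    proof -
      let ?L = "leading (h \<circ> \<pi>)"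
      have fE: "finite (?L E)" using leading_subset[OF E(4)] Z(1) finite_subset by blast
      have cE: "real (card (?L E)) = q + d"
        using card_leading[OF E(1,4) Z(1) injh[OF \<pi>]] dimE by simp
      have cF: "real (card (?L F)) = d" using cardL[OF \<pi>] by (simp add: d_def)
      have "\<pi> \<circ> \<sigma> \<in> P" using \<pi> \<sigma>(1) by (auto simp: P_def intro: permutes_compose)
      then have cFg: "real (card (?L Fg)) = d"
        unfolding lead using card_image[OF inj_on_subset[OF inj_on_act sub]] cardL
        by (simp add: d_def)
      note b = card_Int_bounds[OF leading_mono[OF E(2)] fE, of ?gA]
        card_Int_bounds[OF leading_mono[OF E(3)] fE, of ?gA]
      show ?thesis using b cE cF cFg by linarith
    qed
    have "\<bar>c F ?gA - c Fg ?gA\<bar> \<le> (\<Sum>\<pi>\<in>P. q)"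
      unfolding c_def sum_subtractf[symmetric]
      by (rule order_trans[OF sum_abs sum_mono]) (rule bound)
    also have "\<dots> = N * q" by (simp add: N_def)
    also have "\<dots> \<le> N * (\<epsilon> * d)" using q N by (intro mult_left_mono) auto
    finally show ?thesis by (simp add: shift)
  qed
  show thesis
  proof
    show "0 \<le> \<mu> A" for A using N d by (simp add: \<mu>_def c_def sum_nonneg)
    show "\<mu> A \<le> 1" for A using c_le[of A] N d by (simp add: \<mu>_def)
    show "\<mu> X = 1" using c_total N d by (simp add: \<mu>_def)
    show "\<mu> (A \<union> B) = \<mu> A + \<mu> B" if "A \<inter> B = {}" for A B
      using c_add[OF that] by (simp add: \<mu>_def add_divide_distrib)
    show "\<bar>\<mu> ((\<lambda>x. act x g) ` A) - \<mu> A\<bar> \<le> \<epsilon>" if "A \<subseteq> X" "g \<in> T" for A g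
    proof -
      have "\<mu> ((\<lambda>x. act x g) ` A) - \<mu> A = (c F ((\<lambda>x. act x g) ` A) - c F A) / (N * d)"
        by (simp add: \<mu>_def diff_divide_distrib)
      also have "\<bar>\<dots>\<bar> \<le> N * (\<epsilon> * d) / (N * d)"
        unfolding abs_divide abs_of_pos[OF mult_pos_pos[OF N d]]
        using c_inv[OF that] mult_pos_pos[OF N d] by (intro divide_right_mono) auto
      finally show ?thesis using N d by simp
    qed
  qed
qed

text \<open>By Tychonoff's theorem, the means that are almost invariant under a given \<open>g\<close> up to a given
  error form closed subsets of a compact cube, with the finite intersection property.\<close>

lemma almost_invariant_imp_amenable:
  assumes approx: "\<And>T \<epsilon>. finite T \<Longrightarrow> \<epsilon> > 0 \<Longrightarrow> \<exists>\<mu> :: 'x set \<Rightarrow> real.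
    (\<forall>A. 0 \<le> \<mu> A \<and> \<mu> A \<le> 1) \<and> \<mu> X = 1 \<and>
    (\<forall>A B. A \<inter> B = {} \<longrightarrow> \<mu> (A \<union> B) = \<mu> A + \<mu> B) \<and>
    (\<forall>A g. A \<subseteq> X \<and> g \<in> T \<longrightarrow> \<bar>\<mu> ((\<lambda>x. act x g) ` A) - \<mu> A\<bar> \<le> \<epsilon>)"
  shows amenable
proof -
  define K where "K = (UNIV \<rightarrow>\<^sub>E {0..1} :: ('x set \<Rightarrow> real) set)"
  define C where "C = (\<lambda>(g, n). {\<mu> :: 'x set \<Rightarrow> real. \<mu> X = 1 \<and>
    (\<forall>A B. A \<inter> B = {} \<longrightarrow> \<mu> (A \<union> B) = \<mu> A + \<mu> B) \<and>
    (\<forall>A. A \<subseteq> X \<longrightarrow> \<bar>\<mu> ((\<lambda>x. act x g) ` A) - \<mu> A\<bar> \<le> 1 / real (Suc n))})"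
  have "compactin (product_topology (\<lambda>_. euclideanreal) UNIV) K"
    unfolding K_def compactin_PiE by simp
  then have compact: "compact K" by (simp add: euclidean_product_topology compactin_euclidean_iff)
  \<comment> \<open>Each single equation or inequality involves finitely many coordinates of
    \<open>\<mu>\<close>, and coordinates are continuous in the product topology.\<close>
  have closed: "closed (C i)" for i
    unfolding C_def by (cases i, simp)
      (intro closed_Collect_conj closed_Collect_all closed_Collect_imp closed_Collect_eq
        closed_Collect_le open_Collect_const continuous_intros continuous_on_product_coordinates)
  have fip: "K \<inter> (\<Inter>i\<in>I. C i) \<noteq> {}" if I: "finite I" for I :: "('g \<times> nat) set"
  proof -
    \<comment> \<open>The sum dominates every second component, also when \<open>I\<close> is empty,
      so the tolerance \<open>1 / real (Suc m)\<close> meets all demands of \<open>I\<close> at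
      once.\<close>
    define m where "m = (\<Sum>i\<in>I. snd i)"
    have "finite (fst ` I)" "1 / real (Suc m) > 0" using I by auto
    then obtain \<mu> :: "'x set \<Rightarrow> real" where
      \<mu>: "(\<forall>A. 0 \<le> \<mu> A \<and> \<mu> A \<le> 1) \<and> \<mu> X = 1 \<and>
      (\<forall>A B. A \<inter> B = {} \<longrightarrow> \<mu> (A \<union> B) = \<mu> A + \<mu> B) \<and>
      (\<forall>A g. A \<subseteq> X \<and> g \<in> fst ` I \<longrightarrow> \<bar>\<mu> ((\<lambda>x. act x g) ` A) - \<mu> A\<bar> \<le> 1 / real (Suc m))"
      by (rule approx[THEN exE])
    have "\<mu> \<in> C (g, n)" if "(g, n) \<in> I" for g n
    proof -
      have "n \<le> m" using member_le_sum[OF that, of snd] I by (simp add: m_def)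
      then have "1 / real (Suc m) \<le> 1 / real (Suc n)" by (simp add: frac_le)
      moreover have "g \<in> fst ` I" using that by force
      ultimately have "\<bar>\<mu> ((\<lambda>x. act x g) ` A) - \<mu> A\<bar> \<le> 1 / real (Suc n)" if "A \<subseteq> X" for A
        using \<mu> that by (meson order_trans)
      then show ?thesis using \<mu> by (simp add: C_def)
    qed
    then have "\<mu> \<in> K \<inter> (\<Inter>i\<in>I. C i)" using \<mu> by (auto simp: K_def)
    then show ?thesis by blast
  qed
  have "K \<inter> (\<Inter>i\<in>UNIV. C i) \<noteq> {}"
    by (rule compact_imp_fip_image[OF compact closed fip])
  then obtain \<mu> where K: "\<mu> \<in> K" and C: "\<And>g n. \<mu> \<in> C (g, n)" by blast
  have "invariant_mean X act \<mu>"
  proof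
    show "0 \<le> \<mu> A" "\<mu> A \<le> 1" for A using K by (auto simp: K_def PiE_iff)
    show "\<mu> X = 1" using C by (simp add: C_def)
    show "\<mu> (A \<union> B) = \<mu> A + \<mu> B" if "A \<inter> B = {}" for A B using C that by (simp add: C_def)
    show "\<mu> ((\<lambda>x. act x g) ` A) = \<mu> A" if "A \<subseteq> X" for A g
    proof (rule ccontr)
      assume "\<mu> ((\<lambda>x. act x g) ` A) \<noteq> \<mu> A"
      then have "0 < \<bar>\<mu> ((\<lambda>x. act x g) ` A) - \<mu> A\<bar>" by simp
      then obtain n where "1 / real (Suc n) < \<bar>\<mu> ((\<lambda>x. act x g) ` A) - \<mu> A\<bar>"
        using nat_approx_posE by blast
      moreover have "\<bar>\<mu> ((\<lambda>x. act x g) ` A) - \<mu> A\<bar> \<le> 1 / real (Suc n)"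
        using C[of g n] that by (simp add: C_def)
      ultimately show False by simp
    qed
  qed
  then show ?thesis using amenable_iff_invariant_mean by blast
qed

end

theorem theorem1p4:
  fixes X :: "'x set" and act :: "'x \<Rightarrow> 'g::group_add \<Rightarrow> 'x"
  assumes "right_gset X act"
  shows "right_gset.amenable X act \<longleftrightarrow>
    right_module.amenable
      (scale_pm :: 'k::field \<Rightarrow> ('g \<Rightarrow>\<^sub>0 'k) \<Rightarrow> ('g \<Rightarrow>\<^sub>0 'k))
      (scale_pm :: 'k \<Rightarrow> ('x \<Rightarrow>\<^sub>0 'k) \<Rightarrow> ('x \<Rightarrow>\<^sub>0 'k))
      (span_of X) (linear_act act)"
proof -
  interpret right_gset X act by fact
  show ?thesis
  proof
    assume "right_module.amenable
      (scale_pm :: 'k \<Rightarrow> ('g \<Rightarrow>\<^sub>0 'k) \<Rightarrow> ('g \<Rightarrow>\<^sub>0 'k))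
      (scale_pm :: 'k \<Rightarrow> ('x \<Rightarrow>\<^sub>0 'k) \<Rightarrow> ('x \<Rightarrow>\<^sub>0 'k)) (span_of X) (linear_act act)"
    note am = module_amenable_imp_almost_invariant[OF this]
    show amenable
      by (rule almost_invariant_imp_amenable, rule am, assumption, assumption) blast
  qed (rule amenable_imp_module_amenable)
qed

end
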